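(* Let $k,r\in\mathbb N$ with $r\ge 2$ and let $p$ be a prime with $p^k\ge 3$. Let $H$ be a transfer Krull monoid over the group $G=C_{p^k}^r$. Then $\Delta_{\rho}(H)=\{1\}$.
   Context: $C_m$ is a cyclic group of order $m$ and $C_m^r$ is the direct sum of $r$ copies. $\mathbb N$ denotes the positive integers, $\mathbb N_0=\mathbb N\cup\{0\}$. A monoid is an associative semigroup with unit element; $H^{\times}$ is the group of invertible elements of a monoid $H$. $H$ is unit-cancellative if $au=a$ or $ua=a$ (with $a,u\in H$) implies $u\in H^{\times}$. An atom is an element $u\in H\setminus H^{\times}$ such that $u=ab$ with $a,b\in H$ implies $a\in H^\times$ or $b\in H^\times$; $\mathcal A(H)$ is the set of atoms; $H$ is atomic if every non-unit is a finite product of atoms. For $a\in H\setminus H^\times$, $\mathsf L_H(a)=\mathsf L(a)$ is the set of all $k\in\mathbb N$ such that $a$ is a product of $k$ atoms; $\mathsf L(a)=\{0\}$ for $a\in H^\times$; $\mathcal L(H)=\{\mathsf L(a)\mid a\in H\}$. For nonempty $L\subset\mathbb N$ put $\rho(L)=\sup L/\min L$, and $\rho(\{0\})=1$; $\rho(H)=\sup\{\rho(L)\mid L\in\mathcal L(H)\}$. A set $L\subset\mathbb Z$ is an AAP with difference $d\in\mathbb N$ and length $\ell\in\mathbb N_0$ if $L=y+(L'\cup\{0,d,\ldots,\ell d\}\cup L'')\subset y+d\mathbb Z$ for some $y\in\mathbb Z$ and finite sets $L',L''$ with $L'\subset[-M,-1]$ and $L''\subset \ell d+[1,M]$ for some $M\in\mathbb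 N_0$. $\Delta_\rho(H)$ is the set of all $d\in\mathbb N$ such that for every $k\in\mathbb N$ there is some $L_k\in\mathcal L(H)$ which is an AAP with difference $d$, length at least $k$, and $\rho(L_k)=\rho(H)$. For an additive abelian group $G$, $\mathcal F(G)$ is the free abelian monoid with basis $G$ (written multiplicatively, elements $S=g_1\cdots g_\ell$), and $\mathcal B(G)=\{g_1\cdots g_\ell\in\mathcal F(G)\mid g_1+\ldots+g_\ell=0\}$ is the monoid of zero-sum sequences. A monoid homomorphism $\theta\colon H\to B$ between atomic monoids is a weak transfer homomorphism if (T1) $B=B^\times\theta(H)B^\times$ and $\theta^{-1}(B^\times)=H^\times$; (WT2) whenever $a\in H$, $n\in\mathbb N$, $v_1,\ldots,v_n\in\mathcal A(B)$ and $\theta(a)=v_1\cdots v_n$, there are $u_1,\ldots,u_n\in\mathcal A(H)$ and a permutation $\tau$ of $\{1,\ldots,n\}$ with $a=u_1\cdots u_n$ and $\theta(u_i)\in B^\times v_{\tau(i)}B^\times$ for all $i$. A transfer Krull monoid over $G$ is an atomic unit-cancellative monoid $H$ admitting a weak transfer homomorphism $\theta\colon H\to\mathcal B(G)$. *)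

theory Defs
  imports
    "HOL-Algebra.Product_Groups"
    "HOL-Combinatorics.Permutations"
    "HOL-Computational_Algebra.Primes"
    "HOL-Library.Multiset"
    "HOL-Library.Extended_Nonnegative_Real"
begin

section \<open>Monoids, atoms and sets of lengths\<close>

text \<open>Monoids are the not necessarily commutative monoids of HOL-Algebra. The library predicates
  for irreducibility and factorizations are based on one-sided divisibility and suited to the
  commutative case only, hence the following two-sided notions.\<close>

definition unit_cancellative :: "('a, 'm) monoid_scheme \<Rightarrow> bool" where
  "unit_cancellative H \<longleftrightarrow>
     (\<forall>a\<in>carrier H. \<forall>u\<in>carrier H. a \<otimes>\<^bsub>H\<^esub> u = a \<or> u \<otimes>\<^bsub>H\<^esub> a = a \<longrightarrow> u \<in> Units H)"

definition atoms :: "('a, 'm) monoid_scheme \<Rightarrow> 'a set" where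
  "atoms H = {u \<in> carrier H - Units H.
     \<forall>a\<in>carrier H. \<forall>b\<in>carrier H. u = a \<otimes>\<^bsub>H\<^esub> b \<longrightarrow> a \<in> Units H \<or> b \<in> Units H}"

definition list_prod :: "('a, 'm) monoid_scheme \<Rightarrow> 'a list \<Rightarrow> 'a" where
  "list_prod H xs = foldr (\<otimes>\<^bsub>H\<^esub>) xs \<one>\<^bsub>H\<^esub>"

definition atomic :: "('a, 'm) monoid_scheme \<Rightarrow> bool" where
  "atomic H \<longleftrightarrow>
     (\<forall>a\<in>carrier H - Units H. \<exists>us. set us \<subseteq> atoms H \<and> a = list_prod H us)"

definition lengths :: "('a, 'm) monoid_scheme \<Rightarrow> 'a \<Rightarrow> nat set" where
  "lengths H a =
     (if a \<in> Units H then {0}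
      else {k. 0 < k \<and> (\<exists>us. length us = k \<and> set us \<subseteq> atoms H \<and> a = list_prod H us)})"

definition system_of_lengths :: "('a, 'm) monoid_scheme \<Rightarrow> nat set set" where
  "system_of_lengths H = lengths H ` carrier H"

text \<open>Elasticities may be infinite; for infinite \<open>L\<close> the quotient below is \<open>\<infinity>\<close>.\<close>

definition elasticity_set :: "nat set \<Rightarrow> ennreal" where
  "elasticity_set L =
     (if L = {0} then 1 else (SUP l\<in>L. of_nat l) / of_nat (LEAST l. l \<in> L))"

definition elasticity :: "('a, 'm) monoid_scheme \<Rightarrow> ennreal" where
  "elasticity H = (SUP L\<in>system_of_lengths H. elasticity_set L)"

definition is_AAP :: "int set \<Rightarrow> nat \<Rightarrow> nat \<Rightarrow> bool" where
  "is_AAP L d l \<longleftrightarrow> 0 < d \<and>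
     (\<exists>(y::int) (M::nat) L' L''.
        finite L' \<and> L' \<subseteq> {- int M .. -1} \<and>
        finite L'' \<and> L'' \<subseteq> {int l * int d + 1 .. int l * int d + int M} \<and>
        L = (\<lambda>z. y + z) ` (L' \<union> (\<lambda>i. int i * int d) ` {0..l} \<union> L'') \<and>
        L \<subseteq> range (\<lambda>z. y + int d * z))"

definition Delta_rho :: "('a, 'm) monoid_scheme \<Rightarrow> nat set" where
  "Delta_rho H = {d. 0 < d \<and>
     (\<forall>k>0. \<exists>L\<in>system_of_lengths H.
        (\<exists>l\<ge>k. is_AAP (int ` L) d l) \<and> elasticity_set L = elasticity H)}"

section \<open>Zero-sum sequences and transfer Krull monoids\<close>

text \<open>Groups of HOL-Algebra are written multiplicatively, so the sum of a sequence over an abelian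
  group \<open>G\<close> is a product in \<open>G\<close>. Sequences are multisets, the product of sequences is the sum of
  multisets.\<close>

definition free_abelian_monoid :: "'g set \<Rightarrow> 'g multiset monoid" where
  "free_abelian_monoid A = \<lparr>carrier = {S. set_mset S \<subseteq> A}, monoid.mult = (+), one = {#}\<rparr>"

definition zero_sum_monoid :: "('g, 'm) monoid_scheme \<Rightarrow> 'g multiset monoid" where
  "zero_sum_monoid G = (free_abelian_monoid (carrier G))
     \<lparr>carrier := {mset gs | gs. set gs \<subseteq> carrier G \<and> list_prod G gs = \<one>\<^bsub>G\<^esub>}\<rparr>"

text \<open>A library \<^const>\<open>hom\<close> need not preserve the unit element, a monoid homomorphism does.\<close>

definition weak_transfer_hom ::
    "('a, 'm) monoid_scheme \<Rightarrow> ('b, 'n) monoid_scheme \<Rightarrow> ('a \<Rightarrow> 'b) \<Rightarrow> bool" where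
  "weak_transfer_hom H B \<theta> \<longleftrightarrow>
     monoid H \<and> atomic H \<and> monoid B \<and> atomic B \<and>
     \<theta> \<in> hom H B \<and> \<theta> \<one>\<^bsub>H\<^esub> = \<one>\<^bsub>B\<^esub> \<and>
     carrier B = Units B <#>\<^bsub>B\<^esub> (\<theta> ` carrier H) <#>\<^bsub>B\<^esub> Units B \<and>
     {a \<in> carrier H. \<theta> a \<in> Units B} = Units H \<and>
     (\<forall>a\<in>carrier H. \<forall>vs. vs \<noteq> [] \<and> set vs \<subseteq> atoms B \<and> \<theta> a = list_prod B vs \<longrightarrow>
        (\<exists>us \<tau>. length us = length vs \<and> set us \<subseteq> atoms H \<and> \<tau> permutes {..<length vs} \<and>
           a = list_prod H us \<and>
           (\<forall>i<length vs. \<theta> (us ! i) \<in> Units B <#>\<^bsub>B\<^esub> {vs ! \<tau> i} <#>\<^bsub>B\<^esub> Units B)))"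

definition transfer_Krull :: "('a, 'm) monoid_scheme \<Rightarrow> ('g, 'n) monoid_scheme \<Rightarrow> bool" where
  "transfer_Krull H G \<longleftrightarrow>
     monoid H \<and> atomic H \<and> unit_cancellative H \<and>
     (\<exists>\<theta>. weak_transfer_hom H (zero_sum_monoid G) \<theta>)"

definition cyclic_power :: "nat \<Rightarrow> nat \<Rightarrow> (nat \<Rightarrow> int) monoid" where
  "cyclic_power m r = sum_group {..<r} (\<lambda>_. integer_mod_group m)"

end

theory Submission
  imports Defs "HOL-Number_Theory.Cong"
begin

text \<open>
  A weak transfer homomorphism onto the monoid \<open>\<B>(G)\<close> of zero-sum sequences preserves sets of
  lengths, so only \<open>\<B>(G)\<close> matters. Let \<open>D\<close> be the maximal length of an atom of \<open>\<B>(G)\<close>, the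
  Davenport constant. Counting elements shows that the elasticity is \<open>D / 2\<close>, and that a nonempty
  zero-sum sequence \<open>A\<close> attains it iff \<open>A\<close> is a product of atoms of length \<open>D\<close> and also a product
  of atoms of length two, that is, of atoms \<open>(- g) g\<close>. In particular \<open>g\<close> and \<open>- g\<close> then have the
  same multiplicity in \<open>A\<close>.

  Call \<open>U\<close> a maximal atom if its length is \<open>D\<close>. Everything follows from one property of these
  (\<open>max_atom_consecutive_lengths\<close>): some zero-sum sequence \<open>C\<close> over the elements of \<open>U\<close> and their
  negatives has two consecutive lengths \<open>y\<close> and \<open>y + 1\<close>. High powers of \<open>(- U) U\<close> attain the
  elasticity and are divisible by powers of \<open>C\<close>, whose sets of lengths contain arbitrarily long
  intervals; so 1 is in \<open>\<Delta>\<^sub>\<rho>\<close>. Conversely, if the set of lengths of \<open>A\<close> is an AAP with difference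
  \<open>d\<close> that is long enough and attains the elasticity, then some maximal atom \<open>U\<close> occurs many times
  in a factorization of \<open>A\<close>; by symmetry \<open>C\<close> divides \<open>A\<close>, and two lengths of \<open>A\<close> differ by 1,
  whence \<open>d = 1\<close>. This is \<open>Delta_rho_eq_1\<close>.

  To find \<open>C\<close>, note first that the elements of a maximal atom \<open>U\<close> generate the group: otherwise an
  element \<open>u\<close> of \<open>U\<close> could be replaced by \<open>g\<close> and \<open>u - g\<close> with \<open>g\<close> outside the generated subgroup,
  which gives a longer atom. In a direct sum of copies of a cyclic group of order \<open>n = p\<^sup>k\<close>, a
  minimal generating subset \<open>E\<close> of \<open>U\<close> is a basis (\<open>basis_change\<close>). Suppose that \<open>U\<close> has an
  element \<open>g\<close> with two non-zero coordinates with respect to \<open>E\<close>, one of which is not \<open>n / 2\<close>.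
  There are atoms \<open>V\<close> that consist of one \<open>g\<close> and, for each \<open>e\<close> in \<open>E\<close>, of copies of either \<open>e\<close> or
  \<open>- e\<close>, the choice being free for each \<open>e\<close>. Each \<open>e\<close> with at least \<open>n / 2\<close> copies lets an \<open>n\<close>-th
  power of \<open>e\<close> or \<open>- e\<close> split off from \<open>V\<^sup>2\<close>, and if there is at least one such \<open>e\<close>, then what
  remains is a single atom. So \<open>V\<^sup>2\<close> has the lengths 2 and \<open>1 + q\<close>, with \<open>q\<close> the number of such
  \<open>e\<close>. Changing the choice at a coordinate of \<open>g\<close> other than 0 and \<open>n / 2\<close> changes \<open>q\<close> by one, the
  other non-zero coordinate makes sure that \<open>q\<close> is positive, and the product of the two squares
  has two consecutive lengths (\<open>consecutive_lengths\<close>).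

  Such an element \<open>g\<close> exists (\<open>exists_element_with_two_coords\<close>), because otherwise \<open>U\<close> would
  consist of multiples of basis elements and of elements of order two; then a count, together with
  a linear dependence over the field with two elements, gives a proper zero-sum subsequence of
  \<open>U\<close>.
\<close>

section \<open>Transfer of sets of lengths to zero-sum sequences\<close>

text \<open>Atoms described by subsequences. This is the notion of \<^const>\<open>atoms\<close> for a set of sequences that is
  closed under taking complements of subsequences.\<close>

definition zs_atoms :: "'g multiset set \<Rightarrow> 'g multiset set" where
  "zs_atoms Z = {U \<in> Z. U \<noteq> {#} \<and> (\<forall>T\<in>Z. T \<subseteq># U \<longrightarrow> T = {#} \<or> T = U)}"

text \<open>The empty factorization gives the empty sequence the length 0, so that sets of lengths of
  products can be compared without a case distinction for units.\<close>

definition factor_lengths :: "'g multiset set \<Rightarrow> 'g multiset \<Rightarrow> nat set" where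
  "factor_lengths Z A = {length us | us. set us \<subseteq> zs_atoms Z \<and> sum_list us = A}"

lemma factor_lengthsI:
  "set us \<subseteq> zs_atoms Z \<Longrightarrow> sum_list us = A \<Longrightarrow> length us \<in> factor_lengths Z A"
  unfolding factor_lengths_def by blast

lemma factor_lengthsE:
  assumes "l \<in> factor_lengths Z A"
  obtains us where "set us \<subseteq> zs_atoms Z" "sum_list us = A" "length us = l"
  using assms unfolding factor_lengths_def by blast

lemma factor_lengths_add:
  assumes "a \<in> factor_lengths Z A" "b \<in> factor_lengths Z B"
  shows "a + b \<in> factor_lengths Z (A + B)"
proof -
  obtain us where us: "set us \<subseteq> zs_atoms Z" "sum_list us = A" "length us = a"
    using assms(1) by (rule factor_lengthsE)
  obtain vs where vs: "set vs \<subseteq> zs_atoms Z" "sum_list vs = B" "length vs = b"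
    using assms(2) by (rule factor_lengthsE)
  show ?thesis using factor_lengthsI[of "us @ vs" Z "A + B"] us vs by simp
qed

lemma factor_lengths_empty: "factor_lengths Z {#} = {0}"
proof -
  have "us = []" if "set us \<subseteq> zs_atoms Z" "sum_list us = {#}" for us
    using that by (cases us) (auto simp: zs_atoms_def)
  then show ?thesis by (auto simp: factor_lengths_def intro: exI[of _ "[]"])
qed

lemma factor_lengths_atom: "U \<in> zs_atoms Z \<Longrightarrow> 1 \<in> factor_lengths Z U"
  using factor_lengthsI[of "[U]"] by simp

lemma factor_lengths_sum:
  assumes "finite F" "\<And>x. x \<in> F \<Longrightarrow> f x \<in> factor_lengths Z (A x)"
  shows "sum f F \<in> factor_lengths Z (sum A F)"
  using assms by (induction rule: finite_induct) (auto simp: factor_lengths_empty factor_lengths_add)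

lemma factor_lengths_repeat:
  assumes "a \<in> factor_lengths Z A"
  shows "m * a \<in> factor_lengths Z (repeat_mset m A)"
  using assms by (induction m) (auto simp: factor_lengths_empty factor_lengths_add)

lemma zero_notin_factor_lengths: "A \<noteq> {#} \<Longrightarrow> 0 \<notin> factor_lengths Z A"
  by (auto simp: factor_lengths_def)

lemma mult_zero_sum_monoid [simp]: "x \<otimes>\<^bsub>zero_sum_monoid G\<^esub> y = x + y"
  and one_zero_sum_monoid [simp]: "\<one>\<^bsub>zero_sum_monoid G\<^esub> = {#}"
  by (simp_all add: zero_sum_monoid_def free_abelian_monoid_def)

lemma list_prod_zero_sum_monoid: "list_prod (zero_sum_monoid G) us = sum_list us"
  unfolding list_prod_def by (induction us) auto

lemma list_prod_Cons: "list_prod M (x # xs) = x \<otimes>\<^bsub>M\<^esub> list_prod M xs"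
  and list_prod_Nil: "list_prod M [] = \<one>\<^bsub>M\<^esub>"
  by (simp_all add: list_prod_def)

lemma list_prod_closed: "monoid M \<Longrightarrow> set xs \<subseteq> carrier M \<Longrightarrow> list_prod M xs \<in> carrier M"
  by (induction xs) (auto simp: list_prod_def monoid.m_closed monoid.one_closed)

lemma Units_zero_sum_monoid:
  assumes "monoid (zero_sum_monoid G)"
  shows "Units (zero_sum_monoid G) = {{#}}"
  using monoid.one_closed[OF assms] by (auto simp: Units_def)

lemma atoms_zero_sum_monoid:
  assumes "monoid (zero_sum_monoid G)"
    and diff: "\<And>S T. S \<in> carrier (zero_sum_monoid G) \<Longrightarrow> T \<in> carrier (zero_sum_monoid G) \<Longrightarrow>
      T \<subseteq># S \<Longrightarrow> S - T \<in> carrier (zero_sum_monoid G)"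
  shows "atoms (zero_sum_monoid G) = zs_atoms (carrier (zero_sum_monoid G))"
proof -
  let ?Z = "carrier (zero_sum_monoid G)"
  have "(\<forall>a\<in>?Z. \<forall>b\<in>?Z. u = a + b \<longrightarrow> a = {#} \<or> b = {#}) \<longleftrightarrow>
      (\<forall>T\<in>?Z. T \<subseteq># u \<longrightarrow> T = {#} \<or> T = u)" if "u \<in> ?Z" for u
  proof (intro iffI ballI impI)
    fix T assume *: "\<forall>a\<in>?Z. \<forall>b\<in>?Z. u = a + b \<longrightarrow> a = {#} \<or> b = {#}" "T \<in> ?Z" "T \<subseteq># u"
    then have "T = {#} \<or> u - T = {#}" using diff[OF that] by simp
    then show "T = {#} \<or> T = u" using *(3) by (metis subset_mset.diff_add add.left_neutral)
  next
    fix a b assume "\<forall>T\<in>?Z. T \<subseteq># u \<longrightarrow> T = {#} \<or> T = u" "a \<in> ?Z" "b \<in> ?Z" "u = a + b"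
    then show "a = {#} \<or> b = {#}" by (metis add_cancel_left_right mset_subset_eq_add_left)
  qed
  then show ?thesis
    by (auto simp: atoms_def zs_atoms_def Units_zero_sum_monoid[OF assms(1)])
qed

lemma lengths_zero_sum_monoid:
  assumes "monoid (zero_sum_monoid G)"
    and "\<And>S T. S \<in> carrier (zero_sum_monoid G) \<Longrightarrow> T \<in> carrier (zero_sum_monoid G) \<Longrightarrow>
      T \<subseteq># S \<Longrightarrow> S - T \<in> carrier (zero_sum_monoid G)"
  shows "lengths (zero_sum_monoid G) A = factor_lengths (carrier (zero_sum_monoid G)) A"
proof (cases "A = {#}")
  case True
  then show ?thesis
    by (simp add: lengths_def Units_zero_sum_monoid[OF assms(1)] factor_lengths_empty)
next
  case False
  have "0 < length us" if "sum_list us = A" for us using that False by (cases us) auto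
  then show ?thesis using False
    by (auto simp: lengths_def Units_zero_sum_monoid[OF assms(1)] factor_lengths_def
        atoms_zero_sum_monoid[OF assms] list_prod_zero_sum_monoid)
qed

text \<open>Because the zero-sum monoid has no unit besides the empty sequence, a weak transfer
  homomorphism maps atoms to atoms: an atom whose image had a factorization of length at least two
  would by lifting be a product of two non-units.\<close>

lemma weak_transfer_hom_atom:
  assumes \<theta>: "weak_transfer_hom H (zero_sum_monoid G) \<theta>" and u: "u \<in> atoms H"
  shows "\<theta> u \<in> atoms (zero_sum_monoid G)"
proof -
  let ?B = "zero_sum_monoid G"
  have H: "monoid H" and B: "monoid ?B" "atomic ?B" and hom: "\<theta> \<in> hom H ?B"
    using \<theta> unfolding weak_transfer_hom_def by auto
  have "{a \<in> carrier H. \<theta> a \<in> {{#}}} = Units H"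
    using \<theta> Units_zero_sum_monoid[OF B(1)] unfolding weak_transfer_hom_def by metis
  then have units: "\<And>a. a \<in> carrier H \<Longrightarrow> \<theta> a = {#} \<longleftrightarrow> a \<in> Units H" by auto
  have uc: "u \<in> carrier H" "u \<notin> Units H" using u by (auto simp: atoms_def)
  have "\<theta> u \<in> carrier ?B - Units ?B"
    using uc units Units_zero_sum_monoid[OF B(1)] hom by (auto simp: hom_def)
  then obtain vs where vs: "set vs \<subseteq> atoms ?B" "\<theta> u = list_prod ?B vs"
    using B(2) unfolding atomic_def by blast
  have "vs \<noteq> []" using vs uc units by (auto simp: list_prod_Nil)
  then obtain us where us: "length us = length vs" "set us \<subseteq> atoms H" "u = list_prod H us"
    using \<theta> uc vs unfolding weak_transfer_hom_def by metis
  have usc: "set us \<subseteq> carrier H - Units H" using us by (auto simp: atoms_def)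
  obtain w ws where w: "us = w # ws" using us \<open>vs \<noteq> []\<close> by (cases us) auto
  have "ws = []"
  proof (cases ws)
    case (Cons x xs)
    have c: "list_prod H ws \<in> carrier H" "list_prod H xs \<in> carrier H"
      using usc w Cons by (auto intro!: list_prod_closed[OF H])
    have "\<theta> (list_prod H ws) = \<theta> x + \<theta> (list_prod H xs)"
      using hom usc w Cons c by (auto simp: hom_def list_prod_Cons)
    moreover have "\<theta> x \<noteq> {#}" using units usc w Cons by auto
    ultimately have "list_prod H ws \<notin> Units H" using units[OF c(1)] by auto
    moreover have "w \<notin> Units H" "w \<in> carrier H" using usc w by auto
    ultimately have False using u us(3) c w unfolding atoms_def by (auto simp: list_prod_Cons)
    then show ?thesis ..
  qed
  then obtain v where "vs = [v]" using us(1) w by (cases vs) auto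
  then show ?thesis using vs by (simp add: list_prod_zero_sum_monoid)
qed

lemma weak_transfer_hom_lengths:
  assumes \<theta>: "weak_transfer_hom H (zero_sum_monoid G) \<theta>" and a: "a \<in> carrier H"
  shows "lengths H a = lengths (zero_sum_monoid G) (\<theta> a)"
proof -
  let ?B = "zero_sum_monoid G"
  have H: "monoid H" and B: "monoid ?B" and hom: "\<theta> \<in> hom H ?B" and one: "\<theta> \<one>\<^bsub>H\<^esub> = {#}"
    using \<theta> unfolding weak_transfer_hom_def by auto
  have "{a \<in> carrier H. \<theta> a \<in> {{#}}} = Units H"
    using \<theta> Units_zero_sum_monoid[OF B] unfolding weak_transfer_hom_def by metis
  then have units: "\<And>a. a \<in> carrier H \<Longrightarrow> \<theta> a = {#} \<longleftrightarrow> a \<in> Units H" by auto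
  have map: "\<theta> (list_prod H us) = list_prod ?B (map \<theta> us)" if "set us \<subseteq> carrier H" for us
    using that
  proof (induction us)
    case (Cons x xs)
    then show ?case using hom list_prod_closed[OF H, of xs] by (auto simp: hom_def list_prod_Cons)
  qed (simp add: list_prod_Nil one)
  have "(\<exists>us. length us = l \<and> set us \<subseteq> atoms H \<and> a = list_prod H us) \<longleftrightarrow>
      (\<exists>vs. length vs = l \<and> set vs \<subseteq> atoms ?B \<and> \<theta> a = list_prod ?B vs)" if "0 < l" for l
  proof
    assume "\<exists>us. length us = l \<and> set us \<subseteq> atoms H \<and> a = list_prod H us"
    then obtain us where us: "length us = l" "set us \<subseteq> atoms H" "a = list_prod H us" by blast
    moreover have "set us \<subseteq> carrier H" using us by (auto simp: atoms_def)
    moreover have "set (map \<theta> us) \<subseteq> atoms ?B" using us weak_transfer_hom_atom[OF \<theta>] by auto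
    ultimately show "\<exists>vs. length vs = l \<and> set vs \<subseteq> atoms ?B \<and> \<theta> a = list_prod ?B vs"
      using map by (intro exI[of _ "map \<theta> us"]) auto
  next
    assume "\<exists>vs. length vs = l \<and> set vs \<subseteq> atoms ?B \<and> \<theta> a = list_prod ?B vs"
    then obtain vs where "length vs = l" "set vs \<subseteq> atoms ?B" "\<theta> a = list_prod ?B vs" by blast
    moreover have "vs \<noteq> []" using calculation that by auto
    ultimately show "\<exists>us. length us = l \<and> set us \<subseteq> atoms H \<and> a = list_prod H us"
      using \<theta> a unfolding weak_transfer_hom_def by metis
  qed
  then show ?thesis using units[OF a]
    by (auto simp: lengths_def Units_zero_sum_monoid[OF B])
qed

lemma weak_transfer_hom_system_of_lengths:
  assumes \<theta>: "weak_transfer_hom H (zero_sum_monoid G) \<theta>"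
  shows "system_of_lengths H = system_of_lengths (zero_sum_monoid G)"
proof -
  let ?B = "zero_sum_monoid G"
  have B: "monoid ?B" and hom: "\<theta> \<in> hom H ?B"
    and "carrier ?B = Units ?B <#>\<^bsub>?B\<^esub> (\<theta> ` carrier H) <#>\<^bsub>?B\<^esub> Units ?B"
    using \<theta> unfolding weak_transfer_hom_def by blast+
  then have "carrier ?B = \<theta> ` carrier H"
    by (auto simp: Units_zero_sum_monoid set_mult_def)
  then have "system_of_lengths ?B = (\<lambda>a. lengths ?B (\<theta> a)) ` carrier H"
    by (auto simp: system_of_lengths_def)
  then show ?thesis
    using weak_transfer_hom_lengths[OF \<theta>] by (simp add: system_of_lengths_def)
qed

section \<open>Zero-sum sequences in coordinates\<close>

text \<open>A group that is isomorphic to a direct sum of copies of \<open>\<int> / n\<int>\<close>, indexed by \<open>I\<close>, is described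
  by the set \<open>V\<close> of its elements, their coordinates modulo \<open>n\<close>, and the set \<open>Z\<close> of zero-sum
  sequences. The group operation is left out on purpose: \<open>Z\<close> determines all sets of lengths, and
  the same \<open>Z\<close> can be seen in two coordinate systems, the given one and one whose basis lies in an
  atom.\<close>

locale coordinates =
  fixes V :: "'g set" and Z :: "'g multiset set" and I :: "'i set" and n :: nat
    and c :: "'g \<Rightarrow> 'i \<Rightarrow> int"
  assumes finite_I: "finite I" and n_ge_3: "3 \<le> n"
    and coord_inj: "\<lbrakk>x \<in> V; y \<in> V; \<And>i. i \<in> I \<Longrightarrow> [c x i = c y i] (mod int n)\<rbrakk> \<Longrightarrow> x = y"
    and coord_surj: "\<exists>x\<in>V. \<forall>i\<in>I. [c x i = f i] (mod int n)"
    and mem_Z: "S \<in> Z \<longleftrightarrow> set_mset S \<subseteq> V \<and> (\<forall>i\<in>I. [(\<Sum>x\<in>#S. c x i) = 0] (mod int n))"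
begin

lemma Z_subset_V: "S \<in> Z \<Longrightarrow> g \<in># S \<Longrightarrow> g \<in> V"
  by (auto simp: mem_Z)

lemma empty_in_Z: "{#} \<in> Z"
  by (simp add: mem_Z)

lemma add_in_Z: "S \<in> Z \<Longrightarrow> T \<in> Z \<Longrightarrow> S + T \<in> Z"
  using cong_add[of _ 0 "int n" _ 0] by (auto simp: mem_Z)

lemma diff_in_Z:
  assumes "S \<in> Z" "T \<in> Z" "T \<subseteq># S"
  shows "S - T \<in> Z"
proof -
  have "S = T + (S - T)" using assms(3) by simp
  then have "(\<Sum>x\<in>#S. c x i) = (\<Sum>x\<in>#T. c x i) + (\<Sum>x\<in>#S - T. c x i)" for i
    by (metis image_mset_union sum_mset.union)
  then have "(\<Sum>x\<in>#S - T. c x i) = (\<Sum>x\<in>#S. c x i) - (\<Sum>x\<in>#T. c x i)" for i by simp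
  then show ?thesis
    using assms cong_diff[of _ 0 "int n" _ 0] by (auto simp: mem_Z dest: in_diffD)
qed

lemma repeat_in_Z: "S \<in> Z \<Longrightarrow> repeat_mset m S \<in> Z"
  by (induction m) (auto simp: empty_in_Z add_in_Z)

lemma atom_in_Z: "U \<in> zs_atoms Z \<Longrightarrow> U \<in> Z" and atom_nonempty: "U \<in> zs_atoms Z \<Longrightarrow> U \<noteq> {#}"
  by (auto simp: zs_atoms_def)

lemma atom_no_proper_zero_sum:
  "U \<in> zs_atoms Z \<Longrightarrow> T \<in> Z \<Longrightarrow> T \<subseteq># U \<Longrightarrow> T = {#} \<or> T = U"
  by (auto simp: zs_atoms_def)

lemma finite_V: "finite V"
proof -
  let ?f = "\<lambda>x. restrict (\<lambda>i. c x i mod int n) I"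
  have "inj_on ?f V"
  proof (rule inj_onI)
    fix x y assume "x \<in> V" "y \<in> V" "?f x = ?f y"
    moreover have "[c x i = c y i] (mod int n)" if "i \<in> I" for i
      using fun_cong[OF \<open>?f x = ?f y\<close>, of i] that by (simp add: cong_def)
    ultimately show "x = y" using coord_inj[of x y] by blast
  qed
  moreover have "?f ` V \<subseteq> (\<Pi>\<^sub>E i\<in>I. {0..<int n})" using n_ge_3 by auto
  moreover have "finite (\<Pi>\<^sub>E i\<in>I. {0..<int n})" using finite_I by (intro finite_PiE) auto
  ultimately show ?thesis by (meson finite_imageD finite_subset)
qed

lemma replicate_in_Z: "g \<in> V \<Longrightarrow> replicate_mset n g \<in> Z"
  by (auto simp: mem_Z cong_0_iff)

definition neg :: "'g \<Rightarrow> 'g" where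
  "neg x = (SOME y. y \<in> V \<and> (\<forall>i\<in>I. [c y i = - c x i] (mod int n)))"

definition zero :: 'g where
  "zero = (SOME y. y \<in> V \<and> (\<forall>i\<in>I. [c y i = 0] (mod int n)))"

lemma neg_in_V: "neg x \<in> V" and neg_coord: "i \<in> I \<Longrightarrow> [c (neg x) i = - c x i] (mod int n)"
proof -
  have "neg x \<in> V \<and> (\<forall>i\<in>I. [c (neg x) i = - c x i] (mod int n))"
    unfolding neg_def by (rule someI_ex) (use coord_surj[of "\<lambda>i. - c x i"] in blast)
  then show "neg x \<in> V" "i \<in> I \<Longrightarrow> [c (neg x) i = - c x i] (mod int n)" by auto
qed

lemma zero_in_V: "zero \<in> V" and zero_coord: "i \<in> I \<Longrightarrow> [c zero i = 0] (mod int n)"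
proof -
  have "zero \<in> V \<and> (\<forall>i\<in>I. [c zero i = 0] (mod int n))"
    unfolding zero_def by (rule someI_ex) (use coord_surj[of "\<lambda>i. 0"] in blast)
  then show "zero \<in> V" "i \<in> I \<Longrightarrow> [c zero i = 0] (mod int n)" by auto
qed

lemma singleton_in_Z_iff: "{#x#} \<in> Z \<longleftrightarrow> x = zero"
proof
  assume "{#x#} \<in> Z"
  then show "x = zero"
    using coord_inj[of x zero] zero_in_V zero_coord by (auto simp: mem_Z cong_def)
qed (use zero_in_V zero_coord in \<open>auto simp: mem_Z\<close>)

lemma pair_in_Z_iff:
  assumes "x \<in> V"
  shows "{#x, y#} \<in> Z \<longleftrightarrow> y = neg x"
proof
  assume *: "{#x, y#} \<in> Z"
  have "[c y i = c (neg x) i] (mod int n)" if "i \<in> I" for i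
  proof -
    have "[c x i + c y i = 0] (mod int n)" using * that by (auto simp: mem_Z)
    then have "[c y i = - c x i] (mod int n)" by (simp add: cong_iff_dvd_diff add.commute)
    then show ?thesis using neg_coord[OF that, of x] by (meson cong_sym cong_trans)
  qed
  then show "y = neg x" using * coord_inj[of y "neg x"] neg_in_V by (auto simp: mem_Z)
next
  assume "y = neg x"
  then show "{#x, y#} \<in> Z"
    using assms neg_in_V neg_coord[of _ x] by (auto simp: mem_Z cong_iff_dvd_diff add.commute)
qed

lemma neg_neg: "x \<in> V \<Longrightarrow> neg (neg x) = x"
  using pair_in_Z_iff[of x "neg x"] pair_in_Z_iff[of "neg x" x] neg_in_V
  by (simp add: add_mset_commute)

lemma neg_eq_iff: "x \<in> V \<Longrightarrow> y \<in> V \<Longrightarrow> neg x = neg y \<longleftrightarrow> x = y"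
  using neg_neg by metis

lemma image_neg_neg: "set_mset S \<subseteq> V \<Longrightarrow> image_mset neg (image_mset neg S) = S"
  by (induction S) (auto simp: neg_neg)

lemma image_neg_in_Z:
  assumes "S \<in> Z"
  shows "image_mset neg S \<in> Z"
proof -
  have "[(\<Sum>x\<in>#image_mset neg S. c x i) = - (\<Sum>x\<in>#S. c x i)] (mod int n)" if "i \<in> I" for i
  proof (induction S)
    case (add x S)
    then show ?case using cong_add[OF neg_coord[OF that, of x] add.IH] by simp
  qed simp
  moreover have "[- (\<Sum>x\<in>#S. c x i) = 0] (mod int n)" if "i \<in> I" for i
    using assms that by (simp add: mem_Z cong_0_iff)
  ultimately show ?thesis using neg_in_V by (auto simp: mem_Z intro: cong_trans)
qed

lemma image_neg_atom:
  assumes U: "U \<in> zs_atoms Z"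
  shows "image_mset neg U \<in> zs_atoms Z"
proof -
  have UV: "set_mset U \<subseteq> V" using atom_in_Z[OF U] by (auto simp: mem_Z)
  have "T = {#} \<or> T = image_mset neg U" if T: "T \<in> Z" "T \<subseteq># image_mset neg U" for T
  proof -
    have TV: "set_mset T \<subseteq> V" using T(1) by (auto simp: mem_Z)
    have "image_mset neg T \<subseteq># U"
      using image_mset_subseteq_mono[OF T(2), of neg] image_neg_neg[OF UV] by simp
    then have "image_mset neg T = {#} \<or> image_mset neg T = U"
      using atom_no_proper_zero_sum[OF U image_neg_in_Z[OF T(1)]] by blast
    then show ?thesis using image_neg_neg[OF TV] by auto
  qed
  then show ?thesis
    using image_neg_in_Z[OF atom_in_Z[OF U]] atom_nonempty[OF U] by (auto simp: zs_atoms_def)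
qed

lemma pair_atom:
  assumes "x \<in> V" "x \<noteq> zero"
  shows "{#x, neg x#} \<in> zs_atoms Z"
proof -
  have nz: "neg x \<noteq> zero"
  proof
    assume "neg x = zero"
    then have "{#x, zero#} - {#zero#} \<in> Z"
      using pair_in_Z_iff[OF assms(1), of "neg x"] singleton_in_Z_iff
      by (intro diff_in_Z) auto
    then show False using assms(2) singleton_in_Z_iff by (auto split: if_splits)
  qed
  have "T = {#} \<or> T = {#x, neg x#}" if T: "T \<in> Z" "T \<subseteq># {#x, neg x#}" for T
  proof -
    have "size T \<le> 2" using size_mset_mono[OF T(2)] by simp
    moreover have "size T \<noteq> 1"
    proof
      assume "size T = 1"
      then obtain y where "T = {#y#}" by (metis One_nat_def size_1_singleton_mset)
      then show False using T assms(2) nz singleton_in_Z_iff[of y]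
        by (auto simp: insert_subset_eq_iff)
    qed
    moreover have "T = {#x, neg x#}" if "size T = 2"
      using T(2) that
      by (metis mset_subset_size size_add_mset size_empty numeral_2_eq_2 nat_neq_iff subset_mset.le_less)
    ultimately show ?thesis by (metis One_nat_def Suc_1 le_SucE le_zero_eq size_eq_0_iff_empty)
  qed
  then show ?thesis using pair_in_Z_iff[OF assms(1)] by (auto simp: zs_atoms_def)
qed

lemma atom_with_zero: "U \<in> zs_atoms Z \<Longrightarrow> zero \<in># U \<Longrightarrow> U = {#zero#}"
  using atom_no_proper_zero_sum[of U "{#zero#}"] singleton_in_Z_iff by auto

text \<open>Each element occurs at most \<open>n\<close> times in an atom, since its \<open>n\<close>-th power has sum zero.\<close>

lemma atom_size_le:
  assumes U: "U \<in> zs_atoms Z"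
  shows "size U \<le> n * card V"
proof -
  have "count U g \<le> n" for g
  proof (rule ccontr)
    assume "\<not> count U g \<le> n"
    moreover from this have "g \<in> V" using Z_subset_V[OF atom_in_Z[OF U], of g]
      by (metis count_inI zero_le)
    ultimately have "replicate_mset n g = U"
      using atom_no_proper_zero_sum[OF U replicate_in_Z, of g] n_ge_3
      by (auto simp: count_le_replicate_mset_subset_eq[symmetric])
    then show False using \<open>\<not> count U g \<le> n\<close> by (metis count_replicate_mset order_refl)
  qed
  then have "size U \<le> (\<Sum>g\<in>set_mset U. n)" unfolding size_multiset_overloaded_eq by (rule sum_mono)
  also have "\<dots> \<le> n * card V"
    using atom_in_Z[OF U] finite_V by (auto simp: mem_Z mult.commute intro!: card_mono)
  finally show ?thesis .
qed

lemma finite_atoms: "finite (zs_atoms Z)"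
proof -
  have "zs_atoms Z \<subseteq> mset ` {xs. set xs \<subseteq> V \<and> length xs \<le> n * card V}"
  proof
    fix U assume U: "U \<in> zs_atoms Z"
    obtain xs where "mset xs = U" using ex_mset by blast
    then show "U \<in> mset ` {xs. set xs \<subseteq> V \<and> length xs \<le> n * card V}"
      using atom_size_le[OF U] atom_in_Z[OF U] by (auto simp: mem_Z)
  qed
  then show ?thesis using finite_lists_length_le[OF finite_V] finite_subset by blast
qed

definition davenport :: nat where
  "davenport = Max (size ` zs_atoms Z)"

lemma atom_size_le_davenport: "U \<in> zs_atoms Z \<Longrightarrow> size U \<le> davenport"
  unfolding davenport_def using finite_atoms by auto

lemma zero_atom: "{#zero#} \<in> zs_atoms Z"
  using singleton_in_Z_iff nonempty_subseteq_mset_eq_single[of _ zero] by (auto simp: zs_atoms_def)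

lemma davenport_attained: "\<exists>U\<in>zs_atoms Z. size U = davenport"
  using Max_in[of "size ` zs_atoms Z"] finite_atoms zero_atom unfolding davenport_def by fastforce

lemma factorization_exists: "A \<in> Z \<Longrightarrow> factor_lengths Z A \<noteq> {}"
proof (induction "size A" arbitrary: A rule: less_induct)
  case less
  show ?case
  proof (cases "A = {#} \<or> A \<in> zs_atoms Z")
    case True
    then show ?thesis using factor_lengths_empty factor_lengths_atom by fastforce
  next
    case False
    then obtain T where T: "T \<in> Z" "T \<subseteq># A" "T \<noteq> {#}" "T \<noteq> A"
      using less.prems by (auto simp: zs_atoms_def)
    have "size T < size A" using T by (simp add: mset_subset_size subset_mset.le_less)
    moreover have "size (A - T) < size A"
      using T by (metis calculation diff_less gr_implies_not0 gr0I size_Diff_submset size_eq_0_iff_empty)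
    ultimately obtain a b where "a \<in> factor_lengths Z T" "b \<in> factor_lengths Z (A - T)"
      using less.hyps T(1) diff_in_Z[OF less.prems T(1,2)] by blast
    then show ?thesis using factor_lengths_add T(2) by (metis empty_iff subset_mset.add_diff_inverse)
  qed
qed

section \<open>Elasticity and symmetry of extremal sequences\<close>

text \<open>The zero element is the only one that forms an atom by itself, and an atom containing it has no
  other element. So its multiplicity is the same in every factorization, and the next two
  estimates correct for it.\<close>

lemma factorization_size_lower:
  "set us \<subseteq> zs_atoms Z \<Longrightarrow> 2 * length us \<le> size (sum_list us) + count (sum_list us) zero"
proof (induction us)
  case (Cons U us)
  have "2 \<le> size U + count U zero"
  proof (cases "zero \<in># U")
    case True
    then show ?thesis using atom_with_zero[of U] Cons.prems by auto
  next
    case False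
    have "size U \<noteq> 1"
    proof
      assume "size U = 1"
      then obtain y where "U = {#y#}" by (metis One_nat_def size_1_singleton_mset)
      then show False using False Cons.prems atom_in_Z[of U] singleton_in_Z_iff by auto
    qed
    moreover have "size U \<noteq> 0" using Cons.prems atom_nonempty by auto
    ultimately show ?thesis by linarith
  qed
  then show ?case using Cons by simp
qed simp

lemma factorization_size_upper:
  "set us \<subseteq> zs_atoms Z \<Longrightarrow>
    size (sum_list us) + (davenport - 1) * count (sum_list us) zero \<le> davenport * length us"
proof (induction us)
  case (Cons U us)
  have "size U + (davenport - 1) * count U zero \<le> davenport"
  proof (cases "zero \<in># U")
    case True
    then show ?thesis
      using atom_with_zero[of U] Cons.prems atom_size_le_davenport[of U] by auto
  next
    case False
    then show ?thesis using Cons.prems atom_size_le_davenport[of U] by (simp add: not_in_iff)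
  qed
  then show ?case using Cons by (simp add: algebra_simps)
qed simp

text \<open>This bounds the elasticity by half of the Davenport constant. The term with the zero element
  shows that a sequence for which equality holds does not contain zero.\<close>

lemma factor_lengths_bound:
  assumes "l \<in> factor_lengths Z A" "l' \<in> factor_lengths Z A" "3 \<le> davenport"
  shows "2 * l + (davenport - 2) * count A zero \<le> davenport * l'"
proof -
  obtain us where us: "set us \<subseteq> zs_atoms Z" "sum_list us = A" "length us = l"
    using assms(1) by (rule factor_lengthsE)
  obtain vs where vs: "set vs \<subseteq> zs_atoms Z" "sum_list vs = A" "length vs = l'"
    using assms(2) by (rule factor_lengthsE)
  have "2 * l \<le> size A + count A zero" "size A + (davenport - 1) * count A zero \<le> davenport * l'"
    using factorization_size_lower[OF us(1)] factorization_size_upper[OF vs(1)] us vs by auto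
  moreover have "(davenport - 1) * count A zero = (davenport - 2) * count A zero + count A zero"
  proof -
    have "davenport - 1 = (davenport - 2) + 1" using assms(3) by simp
    then show ?thesis by (metis add_mult_distrib mult_1)
  qed
  ultimately show ?thesis by linarith
qed

lemma finite_factor_lengths:
  assumes "3 \<le> davenport"
  shows "finite (factor_lengths Z A)"
proof (cases "factor_lengths Z A = {}")
  case False
  then obtain l' where "l' \<in> factor_lengths Z A" by blast
  then have "factor_lengths Z A \<subseteq> {.. davenport * l'}"
    using factor_lengths_bound[OF _ _ assms] by fastforce
  then show ?thesis using finite_subset by blast
qed simp

end

text \<open>Equality in a sum of inequalities forces equality in each of them.\<close>

lemma equal_sizes_if_extremal:
  fixes u :: "'x multiset"
  assumes "\<And>u. u \<in> set us \<Longrightarrow> s \<le> size u" "size (sum_list us) \<le> s * length us" "u \<in> set us"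
  shows "size u = s"
  using assms
proof (induction us)
  case (Cons v us)
  have "s * length us \<le> size (sum_list us)" using Cons.prems(1) by (induction us) (auto intro: add_mono)
  then have "size v \<le> s" "size (sum_list us) \<le> s * length us"
    using Cons.prems(2) Cons.prems(1)[of v] by auto
  then show ?case using Cons by (auto intro: antisym)
qed simp

lemma elasticity_set_finite:
  assumes L: "finite L" "L \<noteq> {}" "0 \<notin> L"
  shows "elasticity_set L = ennreal (real (Max L) / real (Min L))"
proof -
  have "(SUP l\<in>L. of_nat l :: ennreal) = of_nat (Max L)"
  proof (rule antisym)
    show "(SUP l\<in>L. of_nat l :: ennreal) \<le> of_nat (Max L)"
      using L by (intro SUP_least) (simp add: of_nat_mono)
    show "of_nat (Max L) \<le> (SUP l\<in>L. of_nat l :: ennreal)"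
      using L by (intro SUP_upper) simp
  qed
  moreover have "(LEAST l. l \<in> L) = Min L"
    using L by (intro Least_equality) auto
  moreover have "0 < Min L" using L by (metis Min_in gr0I)
  moreover have "L \<noteq> {0}" using L by auto
  ultimately show ?thesis
    by (simp add: elasticity_set_def divide_ennreal ennreal_of_nat_eq_real_of_nat)
qed

text \<open>The initial and the final part of an AAP are arbitrary finite sets when the difference is 1, so
  an interval anywhere in the set is enough.\<close>

lemma is_AAP_1_if_interval:
  assumes L: "finite L" "{y..y + l} \<subseteq> L"
  shows "is_AAP (int ` L) 1 l"
proof -
  let ?M = "y + Max L"
  let ?L' = "(\<lambda>z. int z - int y) ` {z \<in> L. z < y}"
  let ?L'' = "(\<lambda>z. int z - int y) ` {z \<in> L. y + l < z}"
  have "z \<le> Max L" if "z \<in> L" for z using L that by simp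
  then have L'': "?L'' \<subseteq> {int l * int 1 + 1 .. int l * int 1 + int ?M}" by fastforce
  have L': "?L' \<subseteq> {- int ?M .. -1}" by auto
  have "int ` L = (\<lambda>z. int y + z) ` (?L' \<union> (\<lambda>i. int i * int 1) ` {0..l} \<union> ?L'')"
  proof (intro equalityI subsetI)
    fix x assume "x \<in> int ` L"
    then obtain z where z: "z \<in> L" "x = int z" by blast
    consider "z < y" | "y \<le> z" "z \<le> y + l" | "y + l < z" by linarith
    then show "x \<in> (\<lambda>z. int y + z) ` (?L' \<union> (\<lambda>i. int i * int 1) ` {0..l} \<union> ?L'')"
    proof cases
      case 2
      then have "int z - int y \<in> (\<lambda>i. int i * int 1) ` {0..l}"
        by (intro image_eqI[of _ _ "z - y"]) auto
      then show ?thesis using z by (intro image_eqI[of _ _ "int z - int y"]) auto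
    qed (use z in \<open>auto intro!: image_eqI[of _ _ "int z - int y"]\<close>)
  next
    fix x assume "x \<in> (\<lambda>z. int y + z) ` (?L' \<union> (\<lambda>i. int i * int 1) ` {0..l} \<union> ?L'')"
    moreover have "int y + int i \<in> int ` L" if "i \<le> l" for i
      using L(2) that by (intro image_eqI[of _ _ "y + i"]) auto
    ultimately show "x \<in> int ` L" by auto
  qed
  moreover have "int ` L \<subseteq> range (\<lambda>z. int y + int 1 * z)"
    using range_eqI[of _ "\<lambda>z. int y + int 1 * z" "_ - int y"] by auto
  ultimately show ?thesis
    unfolding is_AAP_def using L L' L''
    by (intro conjI exI[of _ "int y"] exI[of _ ?M] exI[of _ ?L'] exI[of _ ?L'']) auto
qed

lemma AAP_dvd_diff:
  assumes "is_AAP (int ` L) d l" "a \<in> L" "b \<in> L"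
  shows "int d dvd int a - int b"
proof -
  obtain y where "int ` L \<subseteq> range (\<lambda>z. y + int d * z)"
    using assms(1) unfolding is_AAP_def by (elim conjE exE) (rule that)
  then have "int a \<in> range (\<lambda>z. y + int d * z)" "int b \<in> range (\<lambda>z. y + int d * z)"
    using assms(2,3) by auto
  then obtain z w where "int a = y + int d * z" "int b = y + int d * w" by (elim rangeE)
  then have "int a - int b = int d * (z - w)" by (simp add: algebra_simps)
  then show ?thesis by simp
qed

lemma AAP_has_large_element:
  assumes "is_AAP (int ` L) d l"
  shows "\<exists>a\<in>L. l \<le> a"
proof -
  obtain y L' L'' where d: "0 < d"
    and L: "int ` L = (\<lambda>z. y + z) ` (L' \<union> (\<lambda>i. int i * int d) ` {0..l} \<union> L'')"
    using assms unfolding is_AAP_def by (elim conjE exE) (rule that)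
  have mem: "y + int i * int d \<in> int ` L" if "i \<le> l" for i
    unfolding L using that by (intro imageI UnI1 UnI2) auto
  have "0 \<le> y" using mem[of 0] by (auto simp del: image_iff)
  moreover obtain a where "a \<in> L" "y + int l * int d = int a" using mem[of l] by blast
  moreover have "int l \<le> int l * int d" using d by (simp add: mult_le_cancel_left1)
  ultimately show ?thesis by (intro bexI[of _ a]) linarith+
qed

lemma set_mset_repeat_mset_subset: "set_mset (repeat_mset k C) \<subseteq> set_mset C"
  by (induction k) auto

lemma count_sum_list_ge: "count_list us U * count U g \<le> count (sum_list us) g"
  by (induction us) auto

context coordinates
begin

lemma count_neg_of_pair:
  assumes u: "u \<in> zs_atoms Z" "size u = 2" and g: "g \<in> V"
  shows "count u (neg g) = count u g"
proof -
  obtain x y where xy: "u = {#x, y#}"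
  proof -
    obtain x v where "u = add_mset x v" using u(2) by (cases u) auto
    moreover from this have "size v = 1" using u(2) by simp
    ultimately show thesis using that size_1_singleton_mset by metis
  qed
  have x: "x \<in> V" using atom_in_Z[OF u(1)] xy by (auto simp: mem_Z)
  have "y = neg x" using pair_in_Z_iff[OF x, of y] atom_in_Z[OF u(1)] xy by simp
  moreover have "x = neg g \<longleftrightarrow> neg x = g" using neg_neg[OF x] neg_neg[OF g] by metis
  moreover have "neg x = neg g \<longleftrightarrow> x = g" using neg_eq_iff[OF x g] .
  ultimately show ?thesis using xy by auto
qed

lemma count_neg_of_pairs:
  assumes "set us \<subseteq> zs_atoms Z" "\<And>u. u \<in> set us \<Longrightarrow> size u = 2" "g \<in> V"
  shows "count (sum_list us) (neg g) = count (sum_list us) g"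
  using assms(1,2) by (induction us) (auto simp: count_neg_of_pair[OF _ _ assms(3)])

lemma count_image_neg:
  "set_mset S \<subseteq> V \<Longrightarrow> h \<in> V \<Longrightarrow> count (image_mset neg S) (neg h) = count S h"
  by (induction S) (auto simp: neg_eq_iff)

lemma size_in_factor_lengths_symmetric:
  assumes "set_mset U \<subseteq> V" "zero \<notin># U"
  shows "size U \<in> factor_lengths Z (U + image_mset neg U)"
  using assms
proof (induction U)
  case (add x U)
  have "1 + size U \<in> factor_lengths Z ({#x, neg x#} + (U + image_mset neg U))"
    using add by (intro factor_lengths_add factor_lengths_atom pair_atom) auto
  then show ?case by (simp add: add_mset_commute)
qed (simp add: factor_lengths_empty)

text \<open>The size of \<open>C\<close> is used as a crude bound for all its multiplicities. Only the elements of \<open>U\<close>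
  need to be frequent in \<open>A\<close>; by symmetry their negatives are frequent as well.\<close>

lemma sub_multiset_if_symmetric:
  assumes C: "set_mset C \<subseteq> set_mset U \<union> neg ` set_mset U"
    and U: "set_mset U \<subseteq> V"
    and large: "\<And>g. g \<in># U \<Longrightarrow> size C \<le> count A g"
    and sym: "\<And>g. g \<in> V \<Longrightarrow> count A (neg g) = count A g"
  shows "C \<subseteq># A"
proof (rule mset_subset_eqI)
  fix g
  show "count C g \<le> count A g"
  proof (cases "g \<in># C")
    case True
    then obtain u where "u \<in># U" "g = u \<or> g = neg u" using C by auto
    then have "size C \<le> count A g" using large[of u] sym[of u] U by auto
    then show ?thesis using count_le_size[of C g] by linarith
  qed (simp add: not_in_iff)
qed

text \<open>When \<open>2 * l = davenport * l'\<close>, both estimates of the size of \<open>A\<close> are equalities, and then so are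
  the corresponding estimates for each single atom.\<close>

lemma factor_lengths_extremal:
  assumes D: "3 \<le> davenport" and l: "l \<in> factor_lengths Z A" "l' \<in> factor_lengths Z A" "2 * l = davenport * l'"
    and us: "set us \<subseteq> zs_atoms Z" "sum_list us = A"
  shows "length us = l' \<Longrightarrow> u \<in> set us \<Longrightarrow> size u = davenport"
    and "length us = l \<Longrightarrow> u \<in> set us \<Longrightarrow> size u = 2"
    and "size A = 2 * l"
proof -
  have z: "count A zero = 0" using factor_lengths_bound[OF l(1,2) D] l(3) D by simp
  obtain vs where vs: "set vs \<subseteq> zs_atoms Z" "sum_list vs = A" "length vs = l"
    using l(1) by (rule factor_lengthsE)
  obtain ws where ws: "set ws \<subseteq> zs_atoms Z" "sum_list ws = A" "length ws = l'"
    using l(2) by (rule factor_lengthsE)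
  show size: "size A = 2 * l"
    using factorization_size_lower[OF vs(1)] factorization_size_upper[OF ws(1)] vs ws z l(3) by simp
  show "size u = 2" if "length us = l" "u \<in> set us"
  proof (rule equal_sizes_if_extremal[of us])
    fix v assume v: "v \<in> set us"
    have "count v zero = 0" using v us z by (metis count_sum_list_ge le_zero_eq mult_is_0 count_list_0_iff)
    then show "2 \<le> size v" using factorization_size_lower[of "[v]"] v us(1) by auto
  qed (use that us size in auto)
  show "size u = davenport" if "length us = l'" "u \<in> set us"
  proof -
    have "size v \<le> davenport" if "v \<in> set us" for v using that us(1) atom_size_le_davenport by auto
    moreover have "size (sum_list us) = davenport * length us"
      using us size l(3) \<open>length us = l'\<close> by simp
    ultimately show ?thesis using that(2)
    proof (induction us)
      case (Cons v vs)
      have "size (sum_list vs) \<le> davenport * length vs"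
        using Cons.prems(1) by (induction vs) (auto intro!: add_mono)
      then have "size v = davenport" "size (sum_list vs) = davenport * length vs"
        using Cons.prems(1)[of v] Cons.prems(2) by auto
      then show ?case using Cons by auto
    qed simp
  qed
qed

lemma elasticity_factor_lengths_le:
  assumes D: "3 \<le> davenport" and A: "A \<in> Z"
  shows "elasticity_set (factor_lengths Z A) \<le> ennreal (real davenport / 2)"
proof (cases "A = {#}")
  case True
  then show ?thesis using D by (simp add: factor_lengths_empty elasticity_set_def one_ennreal_def[symmetric] ennreal_leI flip: ennreal_1)
next
  case False
  let ?L = "factor_lengths Z A"
  have L: "finite ?L" "?L \<noteq> {}" "0 \<notin> ?L"
    using finite_factor_lengths[OF D] factorization_exists[OF A] zero_notin_factor_lengths[OF False] by auto
  have "2 * Max ?L \<le> davenport * Min ?L"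
    using factor_lengths_bound[OF Max_in Min_in D, OF L(1,2) L(1,2)] by linarith
  then have "real (2 * Max ?L) \<le> real (davenport * Min ?L)" by (rule of_nat_mono)
  moreover have "0 < Min ?L" using Min_in[OF L(1,2)] L(3) by (metis gr0I)
  ultimately have "real (Max ?L) / real (Min ?L) \<le> real davenport / 2" by (simp add: field_simps)
  then show ?thesis using elasticity_set_finite[OF L] by (simp add: ennreal_leI)
qed

lemma elasticity_factor_lengths_eqD:
  assumes D: "3 \<le> davenport" and A: "A \<in> Z"
    and el: "elasticity_set (factor_lengths Z A) = ennreal (real davenport / 2)"
  shows "\<exists>l\<in>factor_lengths Z A. \<exists>l'\<in>factor_lengths Z A. 2 * l = davenport * l' \<and> (\<forall>x\<in>factor_lengths Z A. x \<le> l)"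
proof (cases "A = {#}")
  case True
  then show ?thesis by (simp add: factor_lengths_empty)
next
  case False
  let ?L = "factor_lengths Z A"
  have L: "finite ?L" "?L \<noteq> {}" "0 \<notin> ?L"
    using finite_factor_lengths[OF D] factorization_exists[OF A] zero_notin_factor_lengths[OF False] by auto
  have "0 < Min ?L" using Min_in[OF L(1,2)] L(3) by (metis gr0I)
  moreover have "real (Max ?L) / real (Min ?L) = real davenport / 2"
    using el elasticity_set_finite[OF L] by (simp add: ennreal_inj)
  ultimately have "real (2 * Max ?L) = real (davenport * Min ?L)" by (simp add: field_simps)
  then have "2 * Max ?L = davenport * Min ?L" by (simp only: of_nat_eq_iff)
  then show ?thesis using Max_in[OF L(1,2)] Min_in[OF L(1,2)] Max_ge[OF L(1)] by blast
qed

lemma elasticity_factor_lengths_eqI: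
  assumes D: "3 \<le> davenport" and "A \<noteq> {#}"
    and l: "l \<in> factor_lengths Z A" "l' \<in> factor_lengths Z A" "2 * l = davenport * l'"
  shows "elasticity_set (factor_lengths Z A) = ennreal (real davenport / 2)"
proof -
  let ?L = "factor_lengths Z A"
  have L: "finite ?L" "?L \<noteq> {}" "0 \<notin> ?L"
    using finite_factor_lengths[OF D] l zero_notin_factor_lengths[OF assms(2)] by auto
  have "x \<le> l" if "x \<in> ?L" for x using factor_lengths_bound[OF that l(2) D] l(3) by linarith
  then have "Max ?L = l" using L l(1) by (intro Max_eqI) auto
  moreover have "l' \<le> x" if "x \<in> ?L" for x
    using factor_lengths_bound[OF l(1) that D] l(3) D by (simp flip: mult_le_cancel1)
      (metis add_leD1 mult_le_cancel1 not_numeral_le_zero bot_nat_0.not_eq_extremum le_zero_eq)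
  then have "Min ?L = l'" using L l(2) by (intro Min_eqI) auto
  moreover have "real (2 * l) = real (davenport * l')" by (simp only: l(3))
  then have "real l / real l' = real davenport / 2"
    using l(2) L(3) by (cases "l' = 0") (auto simp: field_simps)
  ultimately show ?thesis using elasticity_set_finite[OF L] by simp
qed

text \<open>The power can be factored into the atoms \<open>U\<close> and \<open>- U\<close>, all of maximal length, and also into
  atoms \<open>(- g) g\<close> of length two.\<close>

lemma max_atom_symmetric_power:
  assumes D: "3 \<le> davenport" and U: "U \<in> zs_atoms Z" "size U = davenport" and N: "0 < N"
  defines "A \<equiv> repeat_mset N (U + image_mset neg U)"
  shows "A \<in> Z" "elasticity_set (factor_lengths Z A) = ennreal (real davenport / 2)"
proof -
  have UZ: "U \<in> Z" using atom_in_Z[OF U(1)] .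
  then show "A \<in> Z" unfolding A_def by (intro repeat_in_Z add_in_Z image_neg_in_Z)
  have "zero \<notin># U" using atom_with_zero[OF U(1)] U(2) D by auto
  then have "N * davenport \<in> factor_lengths Z A" unfolding A_def U(2)[symmetric]
    using UZ by (intro factor_lengths_repeat size_in_factor_lengths_symmetric) (auto simp: mem_Z)
  moreover have "N * (1 + 1) \<in> factor_lengths Z A" unfolding A_def
    by (intro factor_lengths_repeat factor_lengths_add factor_lengths_atom image_neg_atom U)
  moreover have "A \<noteq> {#}" unfolding A_def using N atom_nonempty[OF U(1)]
    by (auto simp: repeat_mset_eq_empty_iff)
  ultimately show "elasticity_set (factor_lengths Z A) = ennreal (real davenport / 2)"
    using elasticity_factor_lengths_eqI[OF D, of A "N * davenport" "N * (1 + 1)"] by simp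
qed

text \<open>In \<open>k\<close> copies of \<open>C\<close> one can choose for each copy the factorization of length \<open>y\<close> or that of
  length \<open>y + 1\<close>.\<close>

lemma interval_in_factor_lengths_repeat:
  assumes "y \<in> factor_lengths Z C" "y + 1 \<in> factor_lengths Z C"
  shows "{k * y..k * y + k} \<subseteq> factor_lengths Z (repeat_mset k C)"
proof
  fix x assume x: "x \<in> {k * y..k * y + k}"
  define j where "j = x - k * y"
  have j: "j \<le> k" "x = j + k * y" using x by (auto simp: j_def)
  have "(j + (k - j)) * y = k * y" using j(1) by simp
  then have x_eq: "x = j * (y + 1) + (k - j) * y" using j(2) by (simp add: algebra_simps)
  have "j * (y + 1) + (k - j) * y \<in> factor_lengths Z (repeat_mset j C + repeat_mset (k - j) C)"
    by (intro factor_lengths_add factor_lengths_repeat assms)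
  then show "x \<in> factor_lengths Z (repeat_mset k C)" using j(1) x_eq by (simp flip: repeat_mset_distrib)
qed

text \<open>Consecutive lengths for some sequence over each maximal atom and its negative give both
  inclusions: powers of such a sequence put an interval into a set of lengths of maximal
  elasticity, and the sequence itself divides every sufficiently long sequence of maximal
  elasticity whose shortest factorization repeats the maximal atom often enough.\<close>

theorem Delta_rho_eq_1:
  fixes H :: "('a, 'm) monoid_scheme"
  assumes lengths: "system_of_lengths H = factor_lengths Z ` Z" and D: "3 \<le> davenport"
    and consecutive: "\<And>U. U \<in> zs_atoms Z \<Longrightarrow> size U = davenport \<Longrightarrow>
      \<exists>C\<in>Z. set_mset C \<subseteq> set_mset U \<union> neg ` set_mset U \<and>
        (\<exists>y. y \<in> factor_lengths Z C \<and> y + 1 \<in> factor_lengths Z C)"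
  shows "Delta_rho H = {1}"
proof -
  obtain U0 where U0: "U0 \<in> zs_atoms Z" "size U0 = davenport" using davenport_attained by blast
  have rho: "elasticity H = ennreal (real davenport / 2)"
    unfolding elasticity_def lengths
  proof (intro antisym SUP_least)
    fix L assume "L \<in> factor_lengths Z ` Z"
    then show "elasticity_set L \<le> ennreal (real davenport / 2)"
      using elasticity_factor_lengths_le[OF D] by blast
  next
    show "ennreal (real davenport / 2) \<le> (SUP L\<in>factor_lengths Z ` Z. elasticity_set L)"
      using max_atom_symmetric_power[OF D U0, of 1] by (metis SUP_upper imageI zero_less_one)
  qed
  have UV: "set_mset U \<subseteq> V" if "U \<in> zs_atoms Z" for U using atom_in_Z[OF that] by (auto simp: mem_Z)
  have "1 \<in> Delta_rho H"
    unfolding Delta_rho_def lengths rho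
  proof (intro CollectI conjI allI impI)
    fix k :: nat assume k: "0 < k"
    obtain C y where C: "C \<in> Z" "set_mset C \<subseteq> set_mset U0 \<union> neg ` set_mset U0"
      and y: "y \<in> factor_lengths Z C" "y + 1 \<in> factor_lengths Z C"
      using consecutive[OF U0] by blast
    define B where "B = repeat_mset k C"
    define N where "N = Suc (size B)"
    define A where "A = repeat_mset N (U0 + image_mset neg U0)"
    have A: "A \<in> Z" "elasticity_set (factor_lengths Z A) = ennreal (real davenport / 2)"
      using max_atom_symmetric_power[OF D U0, of N] unfolding A_def N_def by auto
    have B: "B \<in> Z" "set_mset B \<subseteq> set_mset U0 \<union> neg ` set_mset U0"
      using C(2) repeat_in_Z[OF C(1)] set_mset_repeat_mset_subset[of k C] unfolding B_def by blast+
    have "B \<subseteq># A"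
    proof (rule sub_multiset_if_symmetric[OF B(2) UV[OF U0(1)]])
      fix g assume "g \<in># U0"
      then have "1 \<le> count (U0 + image_mset neg U0) g" by (simp add: Suc_le_eq count_greater_zero_iff)
      then have "N * 1 \<le> count A g" unfolding A_def count_repeat_mset by (intro mult_le_mono) auto
      then show "size B \<le> count A g" by (simp add: N_def)
    next
      fix g assume g: "g \<in> V"
      have eq: "count (image_mset neg U0) (neg h) = count U0 h" if "h \<in> V" for h
        using count_image_neg[OF UV[OF U0(1)] that] .
      show "count A (neg g) = count A g"
        using eq[OF g] eq[OF neg_in_V, of g] neg_neg[OF g] by (simp add: A_def)
    qed
    then have "A = B + (A - B)" by simp
    moreover obtain l where l: "l \<in> factor_lengths Z (A - B)"
      using factorization_exists[OF diff_in_Z[OF A(1) B(1) \<open>B \<subseteq># A\<close>]] by blast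
    ultimately have shift: "x + l \<in> factor_lengths Z A" if "x \<in> factor_lengths Z B" for x
      using factor_lengths_add[OF that l] by metis
    have "{k * y + l..k * y + l + k} \<subseteq> factor_lengths Z A"
    proof
      fix x assume "x \<in> {k * y + l..k * y + l + k}"
      then have "x - l \<in> {k * y..k * y + k}" "x = x - l + l" by auto
      then show "x \<in> factor_lengths Z A"
        using shift[of "x - l"] interval_in_factor_lengths_repeat[OF y, of k] unfolding B_def by auto
    qed
    then have "is_AAP (int ` factor_lengths Z A) 1 k"
      by (rule is_AAP_1_if_interval[OF finite_factor_lengths[OF D]])
    then show "\<exists>L\<in>factor_lengths Z ` Z. (\<exists>l\<ge>k. is_AAP (int ` L) 1 l) \<and>
        elasticity_set L = ennreal (real davenport / 2)"
      using A by (intro bexI[of _ "factor_lengths Z A"]) auto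
  qed simp
  moreover have "d = 1" if d: "d \<in> Delta_rho H" for d
  proof -
    obtain C where C: "\<And>U. U \<in> zs_atoms Z \<Longrightarrow> size U = davenport \<Longrightarrow> C U \<in> Z \<and>
        set_mset (C U) \<subseteq> set_mset U \<union> neg ` set_mset U \<and>
        (\<exists>y. y \<in> factor_lengths Z (C U) \<and> y + 1 \<in> factor_lengths Z (C U))"
      using consecutive by metis
    \<comment> \<open>\<open>N\<close> bounds the sizes of all \<open>C U\<close> at once. An AAP of length \<open>k\<close> belongs to a sequence with more
      than \<open>card (zs_atoms Z) * N\<close> atoms in its shortest factorization, so one of them occurs more
      than \<open>N\<close> times.\<close>
    define N where "N = (\<Sum>U\<in>zs_atoms Z. size (C U))"
    define k where "k = Suc (davenport * (card (zs_atoms Z) * N))"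
    obtain A s where A: "A \<in> Z" "elasticity_set (factor_lengths Z A) = ennreal (real davenport / 2)"
      and AAP: "k \<le> s" "is_AAP (int ` factor_lengths Z A) d s"
      using d unfolding Delta_rho_def lengths rho k_def by blast
    obtain l l' where l: "l \<in> factor_lengths Z A" "l' \<in> factor_lengths Z A" "2 * l = davenport * l'"
      and l_max: "\<forall>x\<in>factor_lengths Z A. x \<le> l"
      using elasticity_factor_lengths_eqD[OF D A] by blast
    have "k \<le> l" using AAP_has_large_element[OF AAP(2)] AAP(1) l_max by force
    then have "davenport * (card (zs_atoms Z) * N) < davenport * l'" using l(3) unfolding k_def by linarith
    then have l'_large: "card (zs_atoms Z) * N < l'" by simp
    obtain us where us: "set us \<subseteq> zs_atoms Z" "sum_list us = A" "length us = l'"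
      using l(2) by (rule factor_lengthsE)
    obtain vs where vs: "set vs \<subseteq> zs_atoms Z" "sum_list vs = A" "length vs = l"
      using l(1) by (rule factor_lengthsE)
    obtain U where U: "U \<in> zs_atoms Z" "N < count_list us U"
    proof (rule ccontr)
      assume "\<not> thesis"
      then have "(\<Sum>U\<in>zs_atoms Z. count_list us U) \<le> (\<Sum>U\<in>zs_atoms Z. N)"
        using that by (intro sum_mono) (meson not_le)
      then show False using sum_count_set[OF us(1) finite_atoms] us(3) l'_large by simp
    qed
    then have U_mem: "U \<in> set us" using count_notin by fastforce
    have U_size: "size U = davenport" using factor_lengths_extremal(1)[OF D l us] us(3) U_mem by blast
    have CU: "C U \<in> Z" "set_mset (C U) \<subseteq> set_mset U \<union> neg ` set_mset U"
      using C[OF U(1) U_size] by auto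
    obtain y where y: "y \<in> factor_lengths Z (C U)" "y + 1 \<in> factor_lengths Z (C U)"
      using C[OF U(1) U_size] by auto
    have sub: "C U \<subseteq># A"
    proof (rule sub_multiset_if_symmetric[OF CU(2) UV[OF U(1)]])
      fix g assume "g \<in># U"
      then have "1 \<le> count U g" by (simp add: Suc_le_eq)
      then have "count_list us U * 1 \<le> count_list us U * count U g" by (intro mult_le_mono) auto
      also have "\<dots> \<le> count A g" using count_sum_list_ge[of us U g] us(2) by simp
      finally show "size (C U) \<le> count A g"
        using U member_le_sum[OF U(1), of "\<lambda>U. size (C U)"] finite_atoms unfolding N_def by simp
    next
      fix g assume "g \<in> V"
      then show "count A (neg g) = count A g"
        using count_neg_of_pairs[OF vs(1)] factor_lengths_extremal(2)[OF D l vs(1,2) vs(3)] vs(2) by metis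
    qed
    then obtain t where t: "t \<in> factor_lengths Z (A - C U)"
      using factorization_exists[OF diff_in_Z[OF A(1) CU(1)]] by blast
    have "y + t \<in> factor_lengths Z A" "y + 1 + t \<in> factor_lengths Z A"
      using factor_lengths_add[OF y(1) t] factor_lengths_add[OF y(2) t] sub by auto
    then have "int d dvd int (y + 1 + t) - int (y + t)" using AAP_dvd_diff[OF AAP(2)] by blast
    then show "d = 1" by simp
  qed
  ultimately show ?thesis by blast
qed

end

lemma sum_mset_image_sum:
  fixes h :: "'x \<Rightarrow> 'y :: comm_monoid_add"
  assumes "finite A"
  shows "(\<Sum>x\<in>#sum f A. h x) = (\<Sum>a\<in>A. \<Sum>x\<in>#f a. h x)"
  using assms by (induction rule: finite_induct) auto

section \<open>Consecutive lengths from an element with two coordinates\<close>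

text \<open>Coordinates with respect to a basis consisting of group elements, normalized to representatives
  in \<open>{0..<n}\<close>, so that a coordinate can be compared with \<open>n / 2\<close>.\<close>

locale basis_coordinates = coordinates V Z E n c
  for V :: "'g set" and Z :: "'g multiset set" and E :: "'g set" and n :: nat
    and c :: "'g \<Rightarrow> 'g \<Rightarrow> int" +
  assumes basis_in_V: "E \<subseteq> V"
    and coord_basis: "\<lbrakk>e \<in> E; e' \<in> E\<rbrakk> \<Longrightarrow> c e e' = (if e = e' then 1 else 0)"
    and coord_range: "\<lbrakk>x \<in> V; e \<in> E\<rbrakk> \<Longrightarrow> 0 \<le> c x e \<and> c x e < int n"
    and rank_ge_2: "2 \<le> card E"
begin

lemma small_cong_zero: "[x = 0] (mod int n) \<Longrightarrow> \<bar>x\<bar> < int n \<Longrightarrow> x = 0"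
  using dvd_imp_le_int[of x "int n"] by (auto simp: cong_0_iff)

lemma neg_basis_notin_basis: "e \<in> E \<Longrightarrow> neg e \<notin> E"
proof
  assume e: "e \<in> E" "neg e \<in> E"
  have "[c (neg e) e + 1 = 0] (mod int n)"
    using neg_coord[OF e(1), of e] coord_basis[OF e(1) e(1)] by (simp add: cong_iff_dvd_diff)
  moreover have "c (neg e) e \<in> {0, 1}" using coord_basis[OF e(2,1)] by auto
  ultimately show False using small_cong_zero[of "c (neg e) e + 1"] n_ge_3 by auto
qed

text \<open>Under this condition the multiplicities of \<open>g\<close>, \<open>e\<close> and \<open>- e\<close> in the words below do not
  interfere.\<close>

definition off_basis :: "'g \<Rightarrow> bool" where
  "off_basis g \<longleftrightarrow> g \<in> V \<and> g \<notin> E \<and> g \<notin> neg ` E"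

lemma off_basis_if_two_coords:
  assumes g: "g \<in> V" and e: "e0 \<in> E" "e1 \<in> E" "e0 \<noteq> e1" "c g e0 \<noteq> 0" "c g e1 \<noteq> 0"
  shows "off_basis g"
proof -
  have "g \<notin> E" using e coord_basis[of g e0] coord_basis[of g e1] by (auto split: if_splits)
  moreover have "g \<noteq> neg e" if "e \<in> E" for e
  proof
    assume ge: "g = neg e"
    obtain e' where e': "e' \<in> E" "e' \<noteq> e" "c g e' \<noteq> 0" using e by metis
    then have "[c g e' = 0] (mod int n)"
      using neg_coord[OF e'(1), of e] coord_basis[OF that e'(1)] ge by simp
    then show False using small_cong_zero[of "c g e'"] coord_range[OF g e'(1)] e'(3) by auto
  qed
  ultimately show ?thesis using g by (auto simp: off_basis_def)
qed

text \<open>The sequence \<open>g\<^sup>j\<close> times the product of the powers of \<open>e\<close> with exponent \<open>x e\<close>, where negative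
  exponents stand for powers of \<open>- e\<close>.\<close>

definition word :: "nat \<Rightarrow> 'g \<Rightarrow> ('g \<Rightarrow> int) \<Rightarrow> 'g multiset" where
  "word j g x = replicate_mset j g +
     (\<Sum>e\<in>E. replicate_mset (nat (x e)) e + replicate_mset (nat (- x e)) (neg e))"

lemma word_cong: "(\<And>e. e \<in> E \<Longrightarrow> x e = y e) \<Longrightarrow> word j g x = word j g y"
  unfolding word_def by (intro arg_cong2[of _ _ _ _ "(+)"] sum.cong) auto

lemma word_zero: "(\<And>e. e \<in> E \<Longrightarrow> x e = 0) \<Longrightarrow> word 0 g x = {#}"
  unfolding word_def by simp

lemma count_word:
  "count (word j g x) v = (if v = g then j else 0) +
     (\<Sum>e\<in>E. (if v = e then nat (x e) else 0) + (if v = neg e then nat (- x e) else 0))"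
  unfolding word_def by (auto simp: count_sum intro!: sum.cong)

lemma count_word_self: "off_basis g \<Longrightarrow> count (word j g x) g = j"
  unfolding count_word off_basis_def by (auto intro!: sum.neutral)

lemma count_word_basis:
  assumes "off_basis g" "e \<in> E"
  shows "count (word j g x) e = nat (x e)"
proof -
  have "(\<Sum>d\<in>E. (if e = d then nat (x d) else 0) + (if e = neg d then nat (- x d) else 0)) =
      (\<Sum>d\<in>E. if e = d then nat (x d) else 0)"
    using neg_basis_notin_basis assms by (intro sum.cong) auto
  then show ?thesis
    using assms finite_I unfolding count_word off_basis_def by (auto simp: sum.delta)
qed

lemma count_word_neg_basis:
  assumes "off_basis g" "e \<in> E"
  shows "count (word j g x) (neg e) = nat (- x e)"
proof -
  have "(\<Sum>d\<in>E. (if neg e = d then nat (x d) else 0) + (if neg e = neg d then nat (- x d) else 0)) =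
      (\<Sum>d\<in>E. if e = d then nat (- x d) else 0)"
    using neg_basis_notin_basis[OF assms(2)] assms(2) neg_eq_iff basis_in_V by (intro sum.cong) auto
  then show ?thesis
    using assms finite_I unfolding count_word off_basis_def by (auto simp: sum.delta)
qed

lemma set_mset_word: "set_mset (word j g x) \<subseteq> insert g (E \<union> neg ` E)"
proof
  fix v assume "v \<in># word j g x"
  then have "v \<in># replicate_mset j g \<or>
      (\<exists>e\<in>E. v \<in># replicate_mset (nat (x e)) e + replicate_mset (nat (- x e)) (neg e))"
    unfolding word_def using finite_I by (simp add: set_mset_sum)
  then show "v \<in> insert g (E \<union> neg ` E)" by (auto split: if_splits)
qed

lemma size_word: "size (word j g x) = j + (\<Sum>e\<in>E. nat \<bar>x e\<bar>)"
proof -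
  have "nat (x e) + nat (- x e) = nat \<bar>x e\<bar>" for e by simp
  then show ?thesis unfolding word_def by simp
qed

lemma word_in_Z_iff:
  assumes g: "g \<in> V"
  shows "word j g x \<in> Z \<longleftrightarrow> (\<forall>e\<in>E. [int j * c g e + x e = 0] (mod int n))"
proof -
  have "[(\<Sum>v\<in>#word j g x. c v e) = int j * c g e + x e] (mod int n)" if e: "e \<in> E" for e
  proof -
    have "(\<Sum>v\<in>#word j g x. c v e) = int j * c g e +
        (\<Sum>d\<in>E. int (nat (x d)) * c d e + int (nat (- x d)) * c (neg d) e)"
      unfolding word_def using finite_I by (simp add: sum_mset_image_sum)
    moreover have "[(\<Sum>d\<in>E. int (nat (x d)) * c d e + int (nat (- x d)) * c (neg d) e) =
        (\<Sum>d\<in>E. if e = d then x d else 0)] (mod int n)"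
    proof (rule cong_sum)
      fix d assume d: "d \<in> E"
      have "[int (nat (x d)) * c d e + int (nat (- x d)) * c (neg d) e =
          int (nat (x d)) * c d e + int (nat (- x d)) * (- c d e)] (mod int n)"
        by (intro cong_add cong_mult cong_refl neg_coord e)
      moreover have "int (nat (x d)) * c d e + int (nat (- x d)) * (- c d e) = (if e = d then x d else 0)"
        using coord_basis[OF d e] by auto
      ultimately show "[int (nat (x d)) * c d e + int (nat (- x d)) * c (neg d) e =
          (if e = d then x d else 0)] (mod int n)" by simp
    qed
    ultimately show ?thesis using e finite_I by (simp add: cong_add_lcancel)
  qed
  moreover have "set_mset (word j g x) \<subseteq> V" using set_mset_word[of j g x] g basis_in_V neg_in_V by auto
  ultimately show ?thesis unfolding mem_Z by (meson cong_sym cong_trans)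
qed

text \<open>As only one of \<open>e\<close> and \<open>- e\<close> occurs, subsequences of a word are words whose exponents lie
  between 0 and those of the word.\<close>

lemma sub_word:
  assumes g: "off_basis g" and T: "T \<subseteq># word j g x"
  obtains j' y where "j' \<le> j" "T = word j' g y"
    "\<And>e. e \<in> E \<Longrightarrow> (0 \<le> y e \<and> y e \<le> x e) \<or> (x e \<le> y e \<and> y e \<le> 0)"
proof
  let ?y = "\<lambda>e. int (count T e) - int (count T (neg e))"
  have le: "count T v \<le> count (word j g x) v" for v using T by (rule mset_subset_eq_count)
  show "count T g \<le> j" using le[of g] count_word_self[OF g] by simp
  have 1: "count T e \<le> nat (x e)" "count T (neg e) \<le> nat (- x e)" if "e \<in> E" for e
    using le[of e] le[of "neg e"] count_word_basis[OF g that] count_word_neg_basis[OF g that] by auto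
  then show "(0 \<le> ?y e \<and> ?y e \<le> x e) \<or> (x e \<le> ?y e \<and> ?y e \<le> 0)" if "e \<in> E" for e
    using 1[OF that] by linarith
  show "T = word (count T g) g ?y"
  proof (rule multiset_eqI)
    fix v
    consider "v = g" | "v \<in> E" | e where "e \<in> E" "v = neg e" | "v \<notin> insert g (E \<union> neg ` E)" by blast
    then show "count T v = count (word (count T g) g ?y) v"
    proof cases
      case 1
      then show ?thesis using count_word_self[OF g] by simp
    next
      case 2
      then show ?thesis using count_word_basis[OF g 2] 1[OF 2] by auto
    next
      case (3 e)
      then show ?thesis using count_word_neg_basis[OF g 3(1)] 1[OF 3(1)] by auto
    next
      case 4
      then have "count (word i g z) v = 0" for i z using set_mset_word by (metis not_in_iff subsetD)
      then show ?thesis using le[of v] by simp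
    qed
  qed
qed

text \<open>With exponents smaller than \<open>n\<close> a word without \<open>g\<close> has sum zero only if it is empty. Hence a
  zero-sum subsequence with no \<open>g\<close>, or with all of them, is trivial, and only the intermediate
  multiplicities of \<open>g\<close> need to be excluded.\<close>

lemma word_atom:
  assumes g: "off_basis g" and j: "0 < j" and Z: "word j g x \<in> Z"
    and small: "\<And>e. e \<in> E \<Longrightarrow> \<bar>x e\<bar> < int n"
    and min: "\<And>j' y. \<lbrakk>0 < j'; j' < j; word j' g y \<in> Z;
      \<And>e. e \<in> E \<Longrightarrow> (0 \<le> y e \<and> y e \<le> x e) \<or> (x e \<le> y e \<and> y e \<le> 0)\<rbrakk> \<Longrightarrow> False"
  shows "word j g x \<in> zs_atoms Z"
proof -
  have gV: "g \<in> V" using g by (simp add: off_basis_def)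
  have "T = {#} \<or> T = word j g x" if T: "T \<in> Z" "T \<subseteq># word j g x" for T
  proof -
    obtain j' y where y: "j' \<le> j" "T = word j' g y"
      "\<And>e. e \<in> E \<Longrightarrow> (0 \<le> y e \<and> y e \<le> x e) \<or> (x e \<le> y e \<and> y e \<le> 0)"
      using sub_word[OF g T(2)] by metis
    consider "j' = 0" | "j' = j" using min[of j' y] y T(1) by force
    then show ?thesis
    proof cases
      case 1
      have "y e = 0" if e: "e \<in> E" for e
      proof (rule small_cong_zero)
        show "[y e = 0] (mod int n)" using T(1) e 1 unfolding y(2) word_in_Z_iff[OF gV] by auto
        show "\<bar>y e\<bar> < int n" using y(3)[OF e] small[OF e] by linarith
      qed
      then show ?thesis using word_zero 1 y(2) by blast
    next
      case 2
      have "x e = y e" if e: "e \<in> E" for e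
      proof -
        have "[(int j * c g e + x e) - (int j * c g e + y e) = 0 - 0] (mod int n)"
          using T(1) e 2 Z unfolding y(2) word_in_Z_iff[OF gV] by (intro cong_diff) auto
        moreover have "\<bar>x e - y e\<bar> < int n" using y(3)[OF e] small[OF e] by linarith
        ultimately show ?thesis using small_cong_zero[of "x e - y e"] by simp
      qed
      then have "word j g x = word j g y" by (rule word_cong)
      then show ?thesis using 2 y(2) by simp
    qed
  qed
  moreover have "word j g x \<noteq> {#}" using count_word_self[OF g, of j x] j by auto
  ultimately show ?thesis using Z by (auto simp: zs_atoms_def)
qed

lemma replicate_basis_atom:
  assumes v: "v \<in> V" "e \<in> E" "[c v e = 1] (mod int n) \<or> [c v e = -1] (mod int n)"
  shows "replicate_mset n v \<in> zs_atoms Z"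
proof -
  have "T = {#} \<or> T = replicate_mset n v" if T: "T \<in> Z" "T \<subseteq># replicate_mset n v" for T
  proof -
    obtain m where m: "m \<le> n" "T = replicate_mset m v" using T(2) msubseteq_replicate_msetE by metis
    have "[int m * c v e = 0] (mod int n)" using T(1) v(2) unfolding m(2) by (auto simp: mem_Z)
    moreover have "[int m * c v e = int m] (mod int n) \<or> [int m * c v e = - int m] (mod int n)"
      using v(3) cong_mult[OF cong_refl, of "c v e" 1 _ "int m"] cong_mult[OF cong_refl, of "c v e" "-1" _ "int m"] by auto
    ultimately have "int n dvd int m" by (metis cong_0_iff cong_sym cong_trans dvd_minus_iff)
    then have "m = 0 \<or> m = n" using m(1) by (meson dvd_imp_le int_dvd_int_iff le_antisym neq0_conv)
    then show ?thesis using m by auto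
  qed
  then show ?thesis using replicate_in_Z[OF v(1)] n_ge_3 by (auto simp: zs_atoms_def)
qed

text \<open>In the square of the atom \<open>word 1 g x\<close> the exponents are \<open>2 * x e\<close>. For \<open>e\<close> in \<open>F\<close> an \<open>n\<close>-th
  power, which is an atom, can be split off, and what remains is \<open>word 2 g x'\<close>. For \<open>e\<close> in \<open>F\<close> the
  exponent \<open>x' e\<close> is too small in absolute value to leave room for an exponent congruent to \<open>x e\<close>;
  this prevents the remaining word from having a zero-sum subsequence with exactly one \<open>g\<close>, so it
  is an atom.\<close>

lemma lengths_of_square:
  assumes g: "off_basis g"
    and x: "\<And>e. e \<in> E \<Longrightarrow> \<bar>x e\<bar> < int n" "\<And>e. e \<in> E \<Longrightarrow> [c g e + x e = 0] (mod int n)"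
  defines "F \<equiv> {e \<in> E. int n \<le> 2 * \<bar>x e\<bar>}"
  assumes F: "F \<noteq> {}"
  shows "2 \<in> factor_lengths Z (word 1 g x + word 1 g x)"
    and "1 + card F \<in> factor_lengths Z (word 1 g x + word 1 g x)"
proof -
  have gV: "g \<in> V" using g by (simp add: off_basis_def)
  have atom1: "word 1 g x \<in> zs_atoms Z"
    using x word_in_Z_iff[OF gV, of 1 x] by (intro word_atom[OF g]) auto
  show "2 \<in> factor_lengths Z (word 1 g x + word 1 g x)"
    using factor_lengths_add[OF factor_lengths_atom factor_lengths_atom, OF atom1 atom1] by (simp add: numeral_2_eq_2)
  define x' where "x' e = 2 * x e - (if e \<in> F then (if 0 < x e then int n else - int n) else 0)" for e
  define R where "R e = replicate_mset n (if 0 < x e then e else neg e)" for e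
  have finite_F: "finite F" unfolding F_def using finite_I by simp
  have F_iff: "e \<in> F \<longleftrightarrow> int n \<le> 2 * \<bar>x e\<bar>" if "e \<in> E" for e using that by (simp add: F_def)
  have "word 1 g x + word 1 g x = word 2 g x' + (\<Sum>e\<in>F. R e)"
  proof -
    let ?w = "\<lambda>x e. replicate_mset (nat (x e)) e + replicate_mset (nat (- x e)) (neg e)"
    have "?w x e + ?w x e = ?w x' e + (if e \<in> F then R e else {#})" if e: "e \<in> E" for e
      using F_iff[OF e] n_ge_3 by (intro multiset_eqI) (auto simp: x'_def R_def)
    then have "(\<Sum>e\<in>E. ?w x e) + (\<Sum>e\<in>E. ?w x e) = (\<Sum>e\<in>E. ?w x' e) + (\<Sum>e\<in>E. if e \<in> F then R e else {#})"
      by (simp flip: sum.distrib)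
    moreover have "(\<Sum>e\<in>E. if e \<in> F then R e else {#}) = (\<Sum>e\<in>F. R e)"
      using finite_I unfolding F_def by (subst sum.inter_filter[symmetric]) auto
    ultimately show ?thesis
      unfolding word_def by (simp add: numeral_2_eq_2 ac_simps)
  qed
  moreover have "word 2 g x' \<in> zs_atoms Z"
  proof (rule word_atom[OF g])
    have "[int 2 * c g e + x' e = 0] (mod int n)" if e: "e \<in> E" for e
    proof -
      have "int n dvd 2 * (c g e + x e)" using x(2)[OF e] unfolding cong_0_iff by (rule dvd_mult)
      then have "int n dvd 2 * (c g e + x e) - (if e \<in> F then (if 0 < x e then int n else - int n) else 0)"
        by (intro dvd_diff) auto
      then show ?thesis by (simp add: cong_0_iff x'_def algebra_simps)
    qed
    then show "word 2 g x' \<in> Z" using word_in_Z_iff[OF gV] by blast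
    show "\<bar>x' e\<bar> < int n" if e: "e \<in> E" for e
      using x(1)[OF e] F_iff[OF e] by (auto simp: x'_def)
  next
    fix j' y assume *: "0 < j'" "j' < (2::nat)" "word j' g y \<in> Z"
      "\<And>e. e \<in> E \<Longrightarrow> (0 \<le> y e \<and> y e \<le> x' e) \<or> (x' e \<le> y e \<and> y e \<le> 0)"
    obtain e where e: "e \<in> E" "e \<in> F" using F by (auto simp: F_def)
    have "j' = 1" using *(1,2) by simp
    then have "[c g e + y e = 0] (mod int n)" using *(3) e(1) word_in_Z_iff[OF gV] by auto
    then have "[(c g e + x e) - (c g e + y e) = 0 - 0] (mod int n)"
      using x(2)[OF e(1)] by (intro cong_diff)
    then have "[x e - y e = 0] (mod int n)" by simp
    moreover have "\<bar>x e - y e\<bar> < int n" "x e \<noteq> y e"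
      using *(4)[OF e(1)] e(2) F_iff[OF e(1)] x(1)[OF e(1)] n_ge_3 by (auto simp: x'_def split: if_splits)
    ultimately show False using small_cong_zero by fastforce
  qed simp
  moreover have "(\<Sum>e\<in>F. 1) \<in> factor_lengths Z (\<Sum>e\<in>F. R e)"
  proof (rule factor_lengths_sum[OF finite_F])
    fix e assume "e \<in> F"
    then have e: "e \<in> E" by (simp add: F_def)
    have "R e \<in> zs_atoms Z" unfolding R_def
      using coord_basis[OF e e] neg_coord[OF e, of e] e basis_in_V neg_in_V
      by (intro replicate_basis_atom[OF _ e]) auto
    then show "1 \<in> factor_lengths Z (R e)" by (rule factor_lengths_atom)
  qed
  ultimately show "1 + card F \<in> factor_lengths Z (word 1 g x + word 1 g x)"
    using factor_lengths_add[OF factor_lengths_atom] by simp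
qed

text \<open>For each coordinate \<open>a\<close> of \<open>g\<close>, both \<open>- a\<close> and \<open>n - a\<close> are possible exponents. If \<open>2 * a \<noteq> n\<close>
  and \<open>a \<noteq> 0\<close>, then exactly one of them splits off an \<open>n\<close>-th power in the square. The exponent at
  \<open>e1\<close> is chosen to split in both words, as a splitting coordinate is needed; the two words differ
  at \<open>e0\<close> only, and the numbers of splitting coordinates differ by one.\<close>

lemma consecutive_lengths:
  assumes g: "g \<in> V" and e: "e0 \<in> E" "e1 \<in> E" "e0 \<noteq> e1"
    and nz: "c g e0 \<noteq> 0" "c g e1 \<noteq> 0" and ord: "2 * c g e0 \<noteq> int n"
  shows "\<exists>C\<in>Z. set_mset C \<subseteq> insert g (E \<union> neg ` E) \<and>
    (\<exists>y. y \<in> factor_lengths Z C \<and> y + 1 \<in> factor_lengths Z C)"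
proof -
  have off: "off_basis g" by (rule off_basis_if_two_coords[OF g e nz])
  define long where "long e = (if 2 * c g e \<le> int n then int n - c g e else - c g e)" for e
  define short where "short e = (if 2 * c g e \<le> int n then - c g e else int n - c g e)" for e
  define x0 where "x0 e = (if e = e1 then long e else short e)" for e
  define x1 where "x1 = x0(e0 := long e0)"
  have small: "\<bar>x0 e\<bar> < int n" "\<bar>x1 e\<bar> < int n" if "e \<in> E" for e
    using coord_range[OF g that] nz by (auto simp: x0_def x1_def long_def short_def)
  have cong: "[c g e + x0 e = 0] (mod int n)" "[c g e + x1 e = 0] (mod int n)" for e
    by (auto simp: x0_def x1_def long_def short_def cong_0_iff)
  define F where "F x = {e \<in> E. int n \<le> 2 * \<bar>x e :: int\<bar>}" for x
  have e1: "e1 \<in> F x0" using e coord_range[OF g e(2)] by (auto simp: F_def x0_def long_def)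
  have "F x1 = insert e0 (F x0)" "e0 \<notin> F x0"
    using e coord_range[OF g e(1)] ord by (auto simp: F_def x0_def x1_def long_def short_def)
  moreover have "finite (F x0)" using finite_I by (simp add: F_def)
  ultimately have card: "card (F x1) = card (F x0) + 1" and "F x1 \<noteq> {}" by auto
  define W0 W1 where "W0 = word 1 g x0 + word 1 g x0" and "W1 = word 1 g x1 + word 1 g x1"
  have W0: "2 \<in> factor_lengths Z W0" "1 + card (F x0) \<in> factor_lengths Z W0"
    unfolding W0_def F_def using e1
    by (intro lengths_of_square[OF off small(1) cong(1)]; auto simp: F_def)+
  have W1: "2 \<in> factor_lengths Z W1" "1 + card (F x1) \<in> factor_lengths Z W1"
    unfolding W1_def F_def using \<open>F x1 \<noteq> {}\<close>
    by (intro lengths_of_square[OF off small(2) cong(2)]; auto simp: F_def)+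
  have "W0 \<in> Z" "W1 \<in> Z"
    unfolding W0_def W1_def using cong by (intro add_in_Z; simp add: word_in_Z_iff[OF g])+
  then have "W0 + W1 \<in> Z" by (rule add_in_Z)
  moreover have "set_mset (W0 + W1) \<subseteq> insert g (E \<union> neg ` E)"
    unfolding W0_def W1_def using set_mset_word by auto
  moreover have "3 + card (F x0) \<in> factor_lengths Z (W0 + W1)"
    using factor_lengths_add[OF W0(2) W1(1)] by (simp add: numeral_3_eq_3)
  moreover have "3 + card (F x0) + 1 \<in> factor_lengths Z (W0 + W1)"
    using factor_lengths_add[OF W0(1) W1(2)] card by (simp add: numeral_3_eq_3)
  ultimately show ?thesis by blast
qed

text \<open>The witness consists of \<open>n - 1\<close> copies of each basis element and the sum of the basis, which has
  all coordinates equal to 1.\<close>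

lemma davenport_lower_bound: "card E * (n - 1) + 1 \<le> davenport"
proof -
  obtain g where g: "g \<in> V" "\<And>e. e \<in> E \<Longrightarrow> [c g e = 1] (mod int n)" using coord_surj[of "\<lambda>_. 1"] by blast
  have cg: "c g e = 1" if "e \<in> E" for e
  proof -
    have "[c g e - 1 = 0] (mod int n)" using g(2)[OF that] by (simp add: cong_iff_dvd_diff)
    then show ?thesis using small_cong_zero[of "c g e - 1"] coord_range[OF g(1) that] n_ge_3 by auto
  qed
  obtain e0 e1 where "e0 \<in> E" "e1 \<in> E" "e0 \<noteq> e1"
    using rank_ge_2 by (metis card_le_Suc_iff insertCI numeral_2_eq_2)
  then have off: "off_basis g" using cg by (intro off_basis_if_two_coords[OF g(1), of e0 e1]) auto
  have "word 1 g (\<lambda>_. int n - 1) \<in> zs_atoms Z"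
    using word_in_Z_iff[OF g(1)] n_ge_3 by (intro word_atom[OF off]) (auto simp: cg cong_0_iff)
  from atom_size_le_davenport[OF this] show ?thesis
    using n_ge_3 by (simp add: size_word nat_diff_distrib)
qed

end

section \<open>Zero-sum free sequences over a cyclic group\<close>

definition zero_sum_free :: "nat \<Rightarrow> ('x \<Rightarrow> int) \<Rightarrow> 'x multiset \<Rightarrow> bool" where
  "zero_sum_free n a M \<longleftrightarrow> (\<forall>T. T \<subseteq># M \<longrightarrow> T \<noteq> {#} \<longrightarrow> \<not> [(\<Sum>x\<in>#T. a x) = 0] (mod int n))"

text \<open>Two prefixes with the same sum differ by a zero-sum subsequence.\<close>

lemma zero_sum_free_prefix_sums:
  assumes free: "zero_sum_free n a (mset xs)"
  shows "inj_on (\<lambda>j. (\<Sum>x\<leftarrow>take j xs. a x) mod int n) {..length xs}"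
proof -
  have ne: "(\<Sum>x\<leftarrow>take i xs. a x) mod int n \<noteq> (\<Sum>x\<leftarrow>take j xs. a x) mod int n"
    if "i < j" "j \<le> length xs" for i j
  proof
    assume eq: "(\<Sum>x\<leftarrow>take i xs. a x) mod int n = (\<Sum>x\<leftarrow>take j xs. a x) mod int n"
    let ?ys = "drop i (take j xs)"
    have take: "take j xs = take i xs @ ?ys"
      using that(1) by (metis append_take_drop_id less_imp_le min.absorb1 take_take)
    have "mset ?ys \<subseteq># mset (take j xs @ drop j xs)" unfolding mset_append by (subst (2) take) simp
    then have sub: "mset ?ys \<subseteq># mset xs" by simp
    have "(\<Sum>x\<leftarrow>take j xs. a x) = (\<Sum>x\<leftarrow>take i xs. a x) + (\<Sum>x\<leftarrow>?ys. a x)"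
      by (subst take) simp
    then have "[(\<Sum>x\<leftarrow>?ys. a x) = 0] (mod int n)" using eq by (simp add: cong_iff_dvd_diff mod_eq_dvd_iff)
    moreover have "(\<Sum>x\<leftarrow>?ys. a x) = (\<Sum>x\<in>#mset ?ys. a x)" by (metis mset_map sum_mset_sum_list)
    moreover have "mset ?ys \<noteq> {#}" using that by simp
    ultimately show False using free sub unfolding zero_sum_free_def by metis
  qed
  show ?thesis
  proof (rule inj_onI, rule ccontr)
    fix i j assume "i \<in> {..length xs}" "j \<in> {..length xs}" "i \<noteq> j"
      "(\<Sum>x\<leftarrow>take i xs. a x) mod int n = (\<Sum>x\<leftarrow>take j xs. a x) mod int n"
    then show False using ne[of i j] ne[of j i] by (cases "i < j") auto
  qed
qed

lemma zero_sum_free_size: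
  assumes free: "zero_sum_free n a M" and n: "0 < n"
  shows "size M < n"
proof -
  obtain xs where xs: "mset xs = M" using ex_mset by blast
  let ?f = "\<lambda>j. (\<Sum>x\<leftarrow>take j xs. a x) mod int n"
  have "card {..length xs} \<le> card {0..<int n}"
    using zero_sum_free_prefix_sums[of n a xs] free xs n by (intro card_inj_on_le[of ?f]) auto
  then show ?thesis using xs by auto
qed

text \<open>Order the sequence such that \<open>x\<close> and \<open>y\<close> come first. Exchanging them changes only one prefix
  sum, from \<open>a x\<close> to \<open>a y\<close>; but a maximal zero-sum free sequence has \<open>n\<close> distinct prefix sums
  already (with the empty one), which leaves no room for another value.\<close>

lemma zero_sum_free_maximal_constant:
  assumes free: "zero_sum_free n a M" and n: "0 < n" and size: "n \<le> size M + 1"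
    and xy: "x \<in># M" "y \<in># M"
  shows "[a x = a y] (mod int n)"
proof (rule ccontr)
  assume ne: "\<not> [a x = a y] (mod int n)"
  then have "x \<noteq> y" by auto
  then have y: "y \<in># M - {#x#}" using xy(2) by (simp add: in_diff_count)
  obtain zs where zs: "mset zs = M - {#x#} - {#y#}" using ex_mset by blast
  define xs where "xs = x # y # zs"
  have xs: "mset xs = M" using zs insert_DiffM[OF y] insert_DiffM[OF xy(1)] unfolding xs_def mset.simps by metis
  let ?f = "\<lambda>j. (\<Sum>x\<leftarrow>take j xs. a x) mod int n"
  have "a y mod int n \<noteq> ?f j" if "j \<le> length xs" for j
  proof
    assume eq: "a y mod int n = ?f j"
    consider "j = 0" | "j = 1" | i where "j = Suc (Suc i)" by (metis One_nat_def not0_implies_Suc)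
    then show False
    proof cases
      case 1
      then have "[(\<Sum>x\<in>#{#y#}. a x) = 0] (mod int n)" using eq by (simp add: cong_def)
      then show False using free xy(2) unfolding zero_sum_free_def
        by (metis mset_subset_eq_single empty_not_add_mset)
    next
      case 2
      then show False using eq ne by (simp add: xs_def cong_def)
    next
      case (3 i)
      let ?T = "mset (x # take i zs)"
      have "(\<Sum>x\<leftarrow>take j xs. a x) = (\<Sum>x\<leftarrow>x # take i zs. a x) + a y" by (simp add: 3 xs_def)
      then have "[(\<Sum>x\<leftarrow>x # take i zs. a x) = 0] (mod int n)"
      proof -
        have "int n dvd a y - ((\<Sum>x\<leftarrow>x # take i zs. a x) + a y)"
          using eq \<open>(\<Sum>x\<leftarrow>take j xs. a x) = (\<Sum>x\<leftarrow>x # take i zs. a x) + a y\<close>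
          by (simp only: mod_eq_dvd_iff)
        then have "int n dvd - (\<Sum>x\<leftarrow>x # take i zs. a x)" by simp
        then show ?thesis by (simp only: cong_0_iff dvd_minus_iff)
      qed
      moreover have "(\<Sum>x\<leftarrow>x # take i zs. a x) = (\<Sum>x\<in>#?T. a x)" by (metis mset_map sum_mset_sum_list)
      moreover have "?T \<subseteq># mset xs"
      proof -
        have "mset zs = mset (take i zs) + mset (drop i zs)" by (metis append_take_drop_id mset_append)
        then have "mset xs = ?T + ({#y#} + mset (drop i zs))" by (simp add: xs_def)
        then show ?thesis by (metis mset_subset_eq_add_left)
      qed
      ultimately show False using free xs unfolding zero_sum_free_def
        by (metis mset.simps(2) empty_not_add_mset)
    qed
  qed
  then have "a y mod int n \<notin> ?f ` {..length xs}" by auto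
  then have "card (insert (a y mod int n) (?f ` {..length xs})) = Suc (card {..length xs})"
    using zero_sum_free_prefix_sums[of n a xs] free xs by (simp add: card_image)
  moreover have "card (insert (a y mod int n) (?f ` {..length xs})) \<le> card {0..<int n}"
    using n by (intro card_mono) auto
  ultimately show False using size xs by auto
qed

section \<open>Maximal atoms have an element with two coordinates, not of order two\<close>

text \<open>Linear dependence of more than \<open>card E\<close> vectors over the field with two elements. The proof is a
  count: two subsets of \<open>X\<close> have the same parities, and their symmetric difference has even ones.\<close>

lemma exists_even_subset:
  assumes X: "finite X" and E: "finite E" "card E < card X"
  shows "\<exists>Y. Y \<subseteq> X \<and> Y \<noteq> {} \<and> (\<forall>e\<in>E. even (card {x \<in> Y. P x e}))"
proof -
  let ?f = "\<lambda>Y. {e \<in> E. odd (card {x \<in> Y. P x e})}"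
  have "\<not> inj_on ?f (Pow X)"
  proof
    assume "inj_on ?f (Pow X)"
    then have "card (Pow X) \<le> card (Pow E)" using E(1) by (intro card_inj_on_le[of ?f]) auto
    then show False using X E by (simp add: card_Pow)
  qed
  then obtain Y1 Y2 where Y: "Y1 \<subseteq> X" "Y2 \<subseteq> X" "Y1 \<noteq> Y2" "?f Y1 = ?f Y2"
    unfolding inj_on_def by blast
  let ?Y = "(Y1 - Y2) \<union> (Y2 - Y1)"
  have "even (card {x \<in> ?Y. P x e})" if e: "e \<in> E" for e
  proof -
    let ?c = "\<lambda>Y. card {x \<in> Y. P x e}"
    have fin: "finite Y1" "finite Y2" using X Y(1,2) finite_subset by auto
    have "{x \<in> Y1. P x e} = {x \<in> Y1 - Y2. P x e} \<union> {x \<in> Y1 \<inter> Y2. P x e}"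
      "{x \<in> Y2. P x e} = {x \<in> Y2 - Y1. P x e} \<union> {x \<in> Y1 \<inter> Y2. P x e}"
      "{x \<in> ?Y. P x e} = {x \<in> Y1 - Y2. P x e} \<union> {x \<in> Y2 - Y1. P x e}" by auto
    then have "?c Y1 = ?c (Y1 - Y2) + ?c (Y1 \<inter> Y2)" "?c Y2 = ?c (Y2 - Y1) + ?c (Y1 \<inter> Y2)"
      "?c ?Y = ?c (Y1 - Y2) + ?c (Y2 - Y1)"
      using fin by (auto intro!: card_Un_disjoint)
    moreover have "odd (?c Y1) \<longleftrightarrow> odd (?c Y2)" using Y(4) e by blast
    ultimately show ?thesis by presburger
  qed
  moreover have "?Y \<subseteq> X" "?Y \<noteq> {}" using Y(1-3) by auto
  ultimately show ?thesis by blast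
qed

context basis_coordinates
begin

text \<open>If there is no such element, then each element of \<open>U\<close> either is a multiple of one basis element,
  or has order two. The multiples of a basis element \<open>e\<close> form a zero-sum free sequence \<open>P e\<close> over
  a cyclic group, of length at most \<open>n - 1\<close>, with equality (\<open>e \<in> J\<close>) only for the power of \<open>e\<close>. As
  \<open>U\<close> has length at least \<open>card E * (n - 1) + 1\<close>, the number of elements of order two is larger
  than the number of \<open>e\<close> outside of \<open>J\<close>. So these elements, together with \<open>(n / 2) e\<close> for \<open>e \<in> J\<close>,
  are more than \<open>card E\<close> many in a space of dimension \<open>card E\<close> over the field with two elements,
  and some of them add up to zero. This is a zero-sum subsequence of \<open>U\<close>, and a proper one,
  because it has no more than \<open>n / 2 < n - 1\<close> copies of \<open>e\<close> for \<open>e \<in> J\<close>, and none for the other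
  \<open>e\<close>.\<close>

lemma exists_element_with_two_coords:
  assumes U: "U \<in> zs_atoms Z" "size U = davenport" and EU: "E \<subseteq> set_mset U"
  shows "\<exists>g\<in>#U. \<exists>e0\<in>E. \<exists>e1\<in>E. e0 \<noteq> e1 \<and> c g e0 \<noteq> 0 \<and> c g e1 \<noteq> 0 \<and> 2 * c g e0 \<noteq> int n"
proof (rule ccontr)
  assume "\<not> ?thesis"
  then have bad: "2 * c g e0 = int n"
    if "g \<in># U" "e0 \<in> E" "e1 \<in> E" "e0 \<noteq> e1" "c g e0 \<noteq> 0" "c g e1 \<noteq> 0" for g e0 e1
    using that by blast
  have UZ: "U \<in> Z" and UV: "\<And>g. g \<in># U \<Longrightarrow> g \<in> V" using atom_in_Z[OF U(1)] Z_subset_V by auto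
  have "2 * 2 \<le> card E * (n - 1)" using rank_ge_2 n_ge_3 by (intro mult_le_mono) auto
  then have D: "5 \<le> davenport" using davenport_lower_bound by linarith
  define supp where "supp g = {e \<in> E. c g e \<noteq> 0}" for g
  have supp_basis: "supp e = {e}" if "e \<in> E" for e using coord_basis[OF that] that by (auto simp: supp_def split: if_splits)
  define T where "T = filter_mset (\<lambda>g. \<forall>e\<in>E. supp g \<noteq> {e}) U"
  define P where "P e = filter_mset (\<lambda>g. supp g = {e}) U" for e
  have U_split: "U = T + (\<Sum>e\<in>E. P e)"
  proof (rule multiset_eqI)
    fix v
    have "count (\<Sum>e\<in>E. P e) v = (\<Sum>e\<in>E. if supp v = {e} then count U v else 0)"
      by (auto simp: count_sum P_def intro!: sum.cong)
    also have "\<dots> = (if \<exists>e\<in>E. supp v = {e} then count U v else 0)"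
    proof (cases "\<exists>e\<in>E. supp v = {e}")
      case True
      then obtain d where d: "d \<in> E" "supp v = {d}" by blast
      then have "(\<Sum>e\<in>E. if supp v = {e} then count U v else 0) = (\<Sum>e\<in>E. if d = e then count U v else 0)"
        by (intro sum.cong) auto
      then show ?thesis using d finite_I by (auto simp: sum.delta)
    qed auto
    finally show "count U v = count (T + (\<Sum>e\<in>E. P e)) v" by (auto simp: T_def)
  qed
  have P_free: "zero_sum_free n (\<lambda>g. c g e) (P e)" if e: "e \<in> E" for e
    unfolding zero_sum_free_def
  proof (intro allI impI notI)
    fix S assume S: "S \<subseteq># P e" "S \<noteq> {#}" "[(\<Sum>x\<in>#S. c x e) = 0] (mod int n)"
    have supp_S: "supp x = {e}" if "x \<in># S" for x
      using mset_subset_eqD[OF S(1) that] by (simp add: P_def)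
    have SU: "S \<subseteq># U" using S(1) unfolding P_def by (meson multiset_filter_subset subset_mset.order_trans)
    have "[(\<Sum>x\<in>#S. c x d) = 0] (mod int n)" if d: "d \<in> E" for d
    proof (cases "d = e")
      case False
      then have "c x d = 0" if "x \<in># S" for x using supp_S[OF that] d by (auto simp: supp_def)
      then have "image_mset (\<lambda>x. c x d) S = image_mset (\<lambda>x. 0) S" by (intro image_mset_cong) auto
      then show ?thesis by simp
    qed (use S in simp)
    then have "S \<in> Z" using UV SU by (auto simp: mem_Z dest: mset_subset_eqD)
    then have "S = U" using atom_no_proper_zero_sum[OF U(1)] SU S(2) by blast
    moreover obtain d where "d \<in> E" "d \<noteq> e"
      using rank_ge_2 by (metis card_le_Suc_iff insertCI numeral_2_eq_2)
    ultimately show False using supp_S[of d] supp_basis[of d] EU by auto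
  qed
  have P_size: "size (P e) \<le> n - 1" if "e \<in> E" for e
    using zero_sum_free_size[OF P_free[OF that]] n_ge_3 by simp
  define J where "J = {e \<in> E. size (P e) = n - 1}"
  have count_J: "count U e = n - 1" if e: "e \<in> J" for e
  proof -
    have eE: "e \<in> E" using e by (simp add: J_def)
    have eP: "e \<in># P e" using EU eE supp_basis by (auto simp: P_def)
    have "x = e" if x: "x \<in># P e" for x
    proof (rule coord_inj)
      have xU: "x \<in># U" "supp x = {e}" using x by (auto simp: P_def)
      show "x \<in> V" "e \<in> V" using UV xU eE EU by auto
      show "[c x d = c e d] (mod int n)" if d: "d \<in> E" for d
      proof (cases "d = e")
        case True
        then show ?thesis
          using zero_sum_free_maximal_constant[OF P_free[OF eE] _ _ x eP] e n_ge_3 by (simp add: J_def)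
      next
        case False
        then have "c x d = 0" using xU d by (auto simp: supp_def)
        then show ?thesis using coord_basis[OF eE d] False by simp
      qed
    qed
    then have "P e = replicate_mset (size (P e)) e" using set_mset_subset_singletonD[of "P e" e] by auto
    then have "count (P e) e = n - 1" using e by (metis (mono_tags, lifting) J_def count_replicate_mset mem_Collect_eq)
    then show ?thesis using supp_basis[OF eE] by (simp add: P_def)
  qed
  have T_count: "count U g \<le> 1" and T_coord: "e \<in> E \<Longrightarrow> c g e = 0 \<or> 2 * c g e = int n"
    and T_notin: "g \<notin> E"
    if g: "g \<in># T" for g e
  proof -
    have gU: "g \<in># U" and ns: "supp g \<noteq> {e}" if "e \<in> E" for e using g that by (auto simp: T_def)
    have gU: "g \<in># U" using g by (simp add: T_def)
    show coord: "c g e = 0 \<or> 2 * c g e = int n" if e: "e \<in> E" for e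
    proof (cases "c g e = 0")
      case False
      then obtain d where "d \<in> E" "d \<noteq> e" "c g d \<noteq> 0" using ns[OF e] e by (auto simp: supp_def)
      then show ?thesis using bad[OF gU e] False by blast
    qed simp
    show "g \<notin> E" using ns supp_basis by blast
    show "count U g \<le> 1"
    proof (rule ccontr)
      assume "\<not> count U g \<le> 1"
      then have "replicate_mset 2 g \<subseteq># U" by (simp add: count_le_replicate_mset_subset_eq[symmetric])
      moreover have "replicate_mset 2 g \<in> Z" using UV[OF gU] coord by (fastforce simp: mem_Z cong_0_iff)
      ultimately have "replicate_mset 2 g = U" using atom_no_proper_zero_sum[OF U(1)] by fastforce
      from arg_cong[OF this, of size] show False using U(2) D by simp
    qed
  qed
  have T_set: "size T = card (set_mset T)"
  proof -
    have "count T g = 1" if "g \<in># T" for g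
      using T_count[OF that] that count_eq_zero_iff[of U g] by (auto simp: T_def le_Suc_eq)
    then show ?thesis by (simp add: size_multiset_overloaded_eq)
  qed
  have "size T + card J \<ge> card E + 1"
  proof -
    have "(\<Sum>e\<in>E. size (P e) + (if e \<in> E - J then 1 else 0)) \<le> (\<Sum>e\<in>E. n - 1)"
    proof (rule sum_mono)
      fix e assume "e \<in> E"
      then show "size (P e) + (if e \<in> E - J then 1 else 0) \<le> n - 1" using P_size[of e] by (auto simp: J_def)
    qed
    then have "(\<Sum>e\<in>E. size (P e)) + card (E - J) \<le> card E * (n - 1)"
      using finite_I by (simp add: sum.distrib sum.If_cases Int_def set_diff_eq)
    moreover have "size U = size T + (\<Sum>e\<in>E. size (P e))" by (subst U_split) simp
    moreover have "card (E - J) = card E - card J" "card J \<le> card E"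
      using finite_I by (auto simp: J_def intro!: card_Diff_subset card_mono)
    ultimately show ?thesis using davenport_lower_bound U(2) by linarith
  qed
  moreover have "card (J \<union> set_mset T) = card J + card (set_mset T)"
    using T_notin finite_I by (intro card_Un_disjoint) (auto simp: J_def)
  ultimately have "card E < card (J \<union> set_mset T)" using T_set by simp
  then obtain Y where Y: "Y \<subseteq> J \<union> set_mset T" "Y \<noteq> {}"
    "\<And>e. e \<in> E \<Longrightarrow> even (card {x \<in> Y. c x e \<noteq> 0})"
    using exists_even_subset[of "J \<union> set_mset T" E "\<lambda>x e. c x e \<noteq> 0"] finite_I by (auto simp: J_def)
  have finite_Y: "finite Y" using Y(1) finite_I finite_subset by (fastforce simp: J_def)
  obtain h where h: "n = 2 * h"
  proof -
    have "card J \<le> card E" using finite_I by (auto simp: J_def intro!: card_mono)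
    then have "T \<noteq> {#}" using \<open>size T + card J \<ge> card E + 1\<close> by auto
    then obtain g where g: "g \<in># T" by blast
    have "supp g \<noteq> {}"
    proof
      assume "supp g = {}"
      then have "g = zero"
        using zero_coord zero_in_V UV g by (intro coord_inj) (auto simp: T_def supp_def cong_sym)
      then show False using atom_with_zero[OF U(1)] U(2) D g by (auto simp: T_def)
    qed
    then obtain e where "2 * c g e = int n" using T_coord[OF g] by (auto simp: supp_def)
    then have "even (int n)" by (metis dvd_triv_left)
    then show thesis using that by (auto elim: evenE)
  qed
  \<comment> \<open>The multiple \<open>(n / 2) e\<close> is realized by \<open>h\<close> copies of \<open>e\<close>.\<close>
  define m where "m x = (if x \<in> J then h else 1)" for x
  define S where "S = (\<Sum>x\<in>Y. replicate_mset (m x) x)"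
  have count_S: "count S v = (if v \<in> Y then m v else 0)" for v
    unfolding S_def using finite_Y by (auto simp: count_sum sum.delta)
  have "S \<subseteq># U"
  proof (rule mset_subset_eqI)
    fix v
    show "count S v \<le> count U v"
    proof (cases "v \<in> Y")
      case True
      then consider "v \<in> J" | "v \<in># T" "v \<notin> J" using Y(1) by blast
      then show ?thesis
      proof cases
        case 1
        then show ?thesis using count_J[OF 1] h n_ge_3 1 by (auto simp: count_S m_def)
      next
        case 2
        then show ?thesis by (simp add: count_S m_def T_def Suc_le_eq)
      qed
    qed (simp add: count_S)
  qed
  moreover have "S \<in> Z"
  proof -
    have "int n dvd (\<Sum>x\<in>#S. c x e)" if e: "e \<in> E" for e
    proof -
      have "(\<Sum>x\<in>#S. c x e) = (\<Sum>x\<in>Y. int (m x) * c x e)"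
        unfolding S_def using finite_Y by (simp add: sum_mset_image_sum)
      also have "\<dots> = (\<Sum>x\<in>Y. if c x e \<noteq> 0 then int h else 0)"
      proof (rule sum.cong[OF refl])
        fix x assume "x \<in> Y"
        then consider "x \<in> J" | "x \<in># T" "x \<notin> J" using Y(1) by blast
        then show "int (m x) * c x e = (if c x e \<noteq> 0 then int h else 0)"
        proof cases
          case 1
          then show ?thesis using coord_basis[of x e] e by (auto simp: m_def J_def)
        next
          case 2
          then show ?thesis using T_coord[OF 2(1) e] h by (auto simp: m_def)
        qed
      qed
      also have "\<dots> = int h * int (card {x \<in> Y. c x e \<noteq> 0})"
        using finite_Y by (simp add: sum.If_cases Int_def)
      finally show ?thesis using Y(3)[OF e] h by (auto elim!: evenE)
    qed
    moreover have "set_mset S \<subseteq> V" using \<open>S \<subseteq># U\<close> UV by (auto dest: mset_subset_eqD)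
    ultimately show ?thesis by (simp add: mem_Z cong_0_iff)
  qed
  moreover have "S \<noteq> {#}"
  proof -
    obtain v where "v \<in> Y" using Y(2) by blast
    then have "count S v \<noteq> 0" using h n_ge_3 by (auto simp: count_S m_def)
    then show ?thesis by auto
  qed
  ultimately have "S = U" using atom_no_proper_zero_sum[OF U(1)] by blast
  moreover obtain e where e: "e \<in> E" using rank_ge_2 by fastforce
  moreover have "count S e < count U e"
  proof (cases "e \<in> Y")
    case True
    then have "e \<in> J" using Y(1) T_notin e by blast
    then show ?thesis using count_J[of e] h n_ge_3 by (auto simp: count_S m_def)
  next
    case False
    then show ?thesis using e EU by (auto simp: count_S)
  qed
  ultimately show False by simp
qed

lemma max_atom_consecutive_lengths:
  assumes "U \<in> zs_atoms Z" "size U = davenport" "E \<subseteq> set_mset U"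
  shows "\<exists>C\<in>Z. set_mset C \<subseteq> set_mset U \<union> neg ` set_mset U \<and>
    (\<exists>y. y \<in> factor_lengths Z C \<and> y + 1 \<in> factor_lengths Z C)"
proof -
  obtain g e0 e1 where g: "g \<in># U" "e0 \<in> E" "e1 \<in> E" "e0 \<noteq> e1" "c g e0 \<noteq> 0" "c g e1 \<noteq> 0"
    "2 * c g e0 \<noteq> int n"
    using exists_element_with_two_coords[OF assms] by blast
  have "g \<in> V" using Z_subset_V[OF atom_in_Z[OF assms(1)] g(1)] .
  from consecutive_lengths[OF this g(2-7)] show ?thesis using g(1) assms(3) by blast
qed

end

section \<open>A maximal atom contains a basis of the group\<close>

lemma sub_pair_cases:
  assumes "X \<subseteq># {#g, h#}"
  shows "X = {#} \<or> X = {#g#} \<or> X = {#h#} \<or> X = {#g, h#}"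
proof (cases "g \<in># X")
  case True
  then obtain A where A: "X = add_mset g A" by (metis multi_member_split)
  then have "A \<subseteq># {#h#}" using assms by simp
  then show ?thesis using A nonempty_subseteq_mset_eq_single[of A h] by blast
next
  case False
  then have "X \<subseteq># {#h#}"
    using assms subset_eq_diff_conv[of X "{#g#}" "{#h#}"] diff_single_trivial[OF False]
    by (simp add: add_mset_commute)
  then show ?thesis using nonempty_subseteq_mset_eq_single[of X h] by blast
qed

lemma sum_mset_eq_sum_count:
  fixes h :: "'x \<Rightarrow> int"
  assumes "finite F" "set_mset T \<subseteq> F"
  shows "(\<Sum>x\<in>#T. h x) = (\<Sum>e\<in>F. int (count T e) * h e)"
  using assms(2)
proof (induction T)
  case (add x T)
  have "(\<Sum>e\<in>F. int (count (add_mset x T) e) * h e) =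
      (\<Sum>e\<in>F. (if x = e then h e else 0) + int (count T e) * h e)"
    by (intro sum.cong) (auto simp: algebra_simps)
  also have "\<dots> = h x + (\<Sum>e\<in>F. int (count T e) * h e)"
    using add.prems assms(1) by (simp add: sum.distrib sum.delta)
  finally show ?case using add by simp
qed simp

context coordinates
begin

definition spans :: "'g set \<Rightarrow> bool" where
  "spans E \<longleftrightarrow> (\<forall>f. \<exists>a. \<forall>i\<in>I. [f i = (\<Sum>e\<in>E. a e * c e i)] (mod int n))"

text \<open>Otherwise choose \<open>g\<close> outside of the span and replace an element \<open>u\<close> of \<open>U\<close> by \<open>g\<close> and \<open>h = u -
  g\<close>. A zero-sum subsequence of the new, longer sequence contains both \<open>g\<close> and \<open>h\<close>, or none of
  them, since the other elements lie in the span and \<open>g\<close>, \<open>h\<close> do not. In both cases it is trivial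
  because \<open>U\<close> is an atom.\<close>

lemma spans_max_atom:
  assumes U: "U \<in> zs_atoms Z" "size U = davenport"
  shows "spans (set_mset U)"
  unfolding spans_def
proof (rule ccontr)
  assume "\<not> (\<forall>f. \<exists>a. \<forall>i\<in>I. [f i = (\<Sum>e\<in>set_mset U. a e * c e i)] (mod int n))"
  then obtain f where f: "\<And>a. \<not> (\<forall>i\<in>I. [f i = (\<Sum>e\<in>set_mset U. a e * c e i)] (mod int n))" by blast
  have UZ: "U \<in> Z" using atom_in_Z[OF U(1)] .
  obtain u where u: "u \<in># U" using atom_nonempty[OF U(1)] by blast
  define R where "R = U - {#u#}"
  have UR: "U = {#u#} + R" using u by (simp add: R_def)
  obtain g where g: "g \<in> V" "\<And>i. i \<in> I \<Longrightarrow> [c g i = f i] (mod int n)" using coord_surj[of f] by blast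
  obtain h where h: "h \<in> V" "\<And>i. i \<in> I \<Longrightarrow> [c h i = c u i - f i] (mod int n)"
    using coord_surj[of "\<lambda>i. c u i - f i"] by blast
  have sum_R: "(\<Sum>x\<in>#T. c x i) = (\<Sum>e\<in>set_mset U. int (count T e) * c e i)" if "T \<subseteq># R" for T i
    using that UR by (intro sum_mset_eq_sum_count) (auto dest: mset_subset_eqD)
  let ?W = "{#g, h#} + R"
  have gh: "[c g i + c h i = c u i] (mod int n)" if "i \<in> I" for i
    using cong_add[OF g(2)[OF that] h(2)[OF that]] by simp
  have "?W \<in> Z"
  proof -
    have "[c g i + c h i + (\<Sum>x\<in>#R. c x i) = 0] (mod int n)" if "i \<in> I" for i
    proof -
      have "[c u i + (\<Sum>x\<in>#R. c x i) = 0] (mod int n)" using UZ that by (simp add: UR mem_Z)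
      then show ?thesis using cong_add[OF gh[OF that] cong_refl] cong_trans by blast
    qed
    moreover have "set_mset R \<subseteq> V" using UZ UR by (auto simp: mem_Z)
    ultimately show ?thesis using g(1) h(1) by (simp add: mem_Z add.assoc)
  qed
  moreover have "T = {#} \<or> T = ?W" if T: "T \<in> Z" "T \<subseteq># ?W" for T
  proof -
    \<comment> \<open>Splitting \<open>T\<close> along \<open>R\<close>, and not by counting \<open>g\<close> and \<open>h\<close>, covers the case that \<open>g = h\<close>.\<close>
    define A where "A = T \<inter># R"
    define X where "X = T - R"
    have T_eq: "T = X + A" unfolding A_def X_def by (auto simp: multiset_eq_iff min_def)
    have AR: "A \<subseteq># R" by (simp add: A_def)
    have "X \<subseteq># {#g, h#}" using T(2) by (simp add: X_def subset_eq_diff_conv)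
    from sub_pair_cases[OF this] have "X = {#} \<or> X = {#g#} \<or> X = {#h#} \<or> X = {#g, h#}" .
    moreover have "X \<noteq> {#g#}"
    proof
      assume X: "X = {#g#}"
      have "[f i = (\<Sum>e\<in>set_mset U. (- int (count A e)) * c e i)] (mod int n)" if "i \<in> I" for i
      proof -
        have "[c g i + (\<Sum>x\<in>#A. c x i) = 0] (mod int n)" using T(1) that X by (simp add: T_eq mem_Z)
        from cong_diff[OF this cong_diff_iff_cong_0[THEN iffD2, OF g(2)[OF that]]]
        have "[f i + (\<Sum>x\<in>#A. c x i) = 0] (mod int n)" by (simp add: algebra_simps)
        then show ?thesis by (simp add: cong_iff_dvd_diff sum_R[OF AR] sum_negf)
      qed
      then show False using f[of "\<lambda>e. - int (count A e)"] by blast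
    qed
    moreover have "X \<noteq> {#h#}"
    proof
      assume X: "X = {#h#}"
      let ?a = "\<lambda>e. (if e = u then 1 else 0) + int (count A e)"
      have "[f i = (\<Sum>e\<in>set_mset U. ?a e * c e i)] (mod int n)" if "i \<in> I" for i
      proof -
        have "[c h i + (\<Sum>x\<in>#A. c x i) = 0] (mod int n)" using T(1) that X by (simp add: T_eq mem_Z)
        from cong_diff[OF cong_diff_iff_cong_0[THEN iffD2, OF h(2)[OF that]] this]
        have "[f i = c u i + (\<Sum>x\<in>#A. c x i)] (mod int n)"
          by (simp add: cong_iff_dvd_diff algebra_simps)
        moreover have "(\<Sum>e\<in>set_mset U. (if e = u then 1 else 0) * c e i) = (\<Sum>e\<in>set_mset U. if e = u then c e i else 0)"
          by (intro sum.cong) auto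
        then have "(\<Sum>e\<in>set_mset U. ?a e * c e i) = c u i + (\<Sum>x\<in>#A. c x i)"
          using u by (simp add: sum_R[OF AR] distrib_right sum.distrib)
        ultimately show ?thesis by simp
      qed
      then show False using f[of ?a] by blast
    qed
    moreover have "T = {#}" if "X = {#}"
    proof -
      have "T \<subseteq># U" "T \<noteq> U" using that T_eq AR size_mset_mono[OF AR] UR
        by (auto intro: subset_mset.order_trans)
      then show ?thesis using atom_no_proper_zero_sum[OF U(1) T(1)] by blast
    qed
    moreover have "T = ?W" if X: "X = {#g, h#}"
    proof -
      have "?W - T = R - A" using X T_eq by simp
      moreover have "?W - T \<in> Z" by (rule diff_in_Z[OF \<open>?W \<in> Z\<close> T])
      moreover have "R - A \<subseteq># U"
        unfolding R_def by (metis diff_subset_eq_self subset_mset.order_trans)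
      moreover have "size (R - A) < size U" using UR size_mset_mono[of "R - A" R] by simp
      ultimately have "R - A = {#}" using atom_no_proper_zero_sum[OF U(1), of "R - A"] by auto
      then show ?thesis using AR X T_eq by (metis Diff_eq_empty_iff_mset subset_mset.antisym)
    qed
    ultimately show ?thesis by blast
  qed
  ultimately have "?W \<in> zs_atoms Z" by (auto simp: zs_atoms_def)
  then show False using atom_size_le_davenport[of ?W] U(2) UR by simp
qed

text \<open>This is Nakayama's lemma for the nilpotent ideal generated by \<open>p\<close>: the error term \<open>p * f'\<close> is
  expanded again and again until it is divisible by \<open>p ^ k = n\<close>.\<close>

lemma spans_if_spans_mod_prime:
  assumes n: "n = p ^ k"
    and mod_p: "\<And>f. \<exists>a f'. \<forall>i\<in>I. [f i = (\<Sum>e\<in>E. a e * c e i) + int p * f' i] (mod int n)"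
  shows "spans E"
proof -
  have "\<exists>a f'. \<forall>i\<in>I. [f i = (\<Sum>e\<in>E. a e * c e i) + int p ^ j * f' i] (mod int n)" for f j
  proof (induction j)
    case 0
    show ?case by (rule exI[of _ "\<lambda>_. 0"], rule exI[of _ f]) simp
  next
    case (Suc j)
    then obtain a f' where f': "\<And>i. i \<in> I \<Longrightarrow> [f i = (\<Sum>e\<in>E. a e * c e i) + int p ^ j * f' i] (mod int n)"
      by blast
    obtain b f'' where f'': "\<And>i. i \<in> I \<Longrightarrow> [f' i = (\<Sum>e\<in>E. b e * c e i) + int p * f'' i] (mod int n)"
      using mod_p[of f'] by blast
    have "[f i = (\<Sum>e\<in>E. (a e + int p ^ j * b e) * c e i) + int p ^ Suc j * f'' i] (mod int n)"
      if "i \<in> I" for i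
    proof -
      have "[f i = (\<Sum>e\<in>E. a e * c e i) + int p ^ j * ((\<Sum>e\<in>E. b e * c e i) + int p * f'' i)] (mod int n)"
        using cong_trans[OF f'[OF that]] cong_add[OF cong_refl cong_mult[OF cong_refl f''[OF that]]] by blast
      moreover have "(\<Sum>e\<in>E. a e * c e i) + int p ^ j * ((\<Sum>e\<in>E. b e * c e i) + int p * f'' i) =
          (\<Sum>e\<in>E. (a e + int p ^ j * b e) * c e i) + int p ^ Suc j * f'' i"
        by (simp add: distrib_left distrib_right sum.distrib sum_distrib_left mult.assoc)
      ultimately show ?thesis by simp
    qed
    then show ?case by (intro exI[of _ "\<lambda>e. a e + int p ^ j * b e"] exI[of _ f'']) blast
  qed
  note step = this
  show ?thesis unfolding spans_def
  proof
    fix f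
    obtain a f' where "\<And>i. i \<in> I \<Longrightarrow> [f i = (\<Sum>e\<in>E. a e * c e i) + int p ^ k * f' i] (mod int n)"
      using step[of f k] by blast
    then have "\<forall>i\<in>I. [f i = (\<Sum>e\<in>E. a e * c e i)] (mod int n)"
      using n by (simp add: cong_def)
    then show "\<exists>a. \<forall>i\<in>I. [f i = (\<Sum>e\<in>E. a e * c e i)] (mod int n)" by blast
  qed
qed

text \<open>A relation modulo \<open>p\<close> with a coefficient prime to \<open>p\<close> expresses one element by the others modulo
  \<open>p\<close>, and by Nakayama's lemma this contradicts minimality. So the coefficients of every relation
  modulo \<open>p\<close> are divisible by \<open>p\<close>. A relation modulo \<open>p ^ k\<close> can therefore be divided by \<open>p\<close>
  repeatedly, which shows that its coefficients are divisible by \<open>p ^ k\<close>.\<close>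

lemma minimal_spanning_independent:
  assumes n: "n = p ^ k" and p: "prime p" and E: "finite E" "spans E"
    and min: "\<And>e. e \<in> E \<Longrightarrow> \<not> spans (E - {e})"
    and a: "\<And>i. i \<in> I \<Longrightarrow> [(\<Sum>e\<in>E. a e * c e i) = 0] (mod int n)" and e: "e \<in> E"
  shows "[a e = 0] (mod int n)"
proof -
  have mod_p: "int p dvd b d"
    if b: "\<And>i. i \<in> I \<Longrightarrow> int p dvd (\<Sum>e\<in>E. b e * c e i)" and d: "d \<in> E" for b d
  proof (rule ccontr)
    assume "\<not> int p dvd b d"
    then have "coprime (b d) (int p)"
      using p by (metis coprime_commute prime_imp_coprime prime_int_nat_transfer prime_nat_int_transfer)
    then obtain t where "[b d * t = 1] (mod int p)" using cong_solve_coprime_int by blast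
    then obtain s where s: "t * b d = 1 + int p * s"
      by (metis cong_iff_lin cong_sym mult.commute)
    obtain w where w: "\<And>i. i \<in> I \<Longrightarrow> (\<Sum>e\<in>E. b e * c e i) = int p * w i"
      using b unfolding dvd_def by metis
    have split: "(\<Sum>e\<in>E. f e) = f d + (\<Sum>e\<in>E - {d}. f e)" for f :: "'g \<Rightarrow> int"
      using sum.remove[OF E(1) d] .
    have "spans (E - {d})"
    proof (rule spans_if_spans_mod_prime[OF n])
      fix f
      obtain x where x: "\<And>i. i \<in> I \<Longrightarrow> [f i = (\<Sum>e\<in>E. x e * c e i)] (mod int n)"
        using E(2) unfolding spans_def by blast
      have "(\<Sum>e\<in>E. x e * c e i) = (\<Sum>e\<in>E - {d}. (x e - x d * t * b e) * c e i) +
          int p * (x d * t * w i - x d * s * c d i)" if "i \<in> I" for i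
      proof -
        have "b d * c d i + (\<Sum>e\<in>E - {d}. b e * c e i) = int p * w i"
          using w[OF that] split[of "\<lambda>e. b e * c e i"] by simp
        then have 1: "(\<Sum>e\<in>E - {d}. b e * c e i) = int p * w i - b d * c d i" by linarith
        have "(\<Sum>e\<in>E - {d}. (x e - x d * t * b e) * c e i) =
            (\<Sum>e\<in>E - {d}. x e * c e i) - x d * t * (\<Sum>e\<in>E - {d}. b e * c e i)"
          by (simp add: left_diff_distrib sum_subtractf sum_distrib_left mult.assoc)
        also have "\<dots> = (\<Sum>e\<in>E - {d}. x e * c e i) - x d * t * (int p * w i) + x d * (t * b d) * c d i"
          unfolding 1 by (simp add: algebra_simps)
        finally show ?thesis unfolding s split[of "\<lambda>e. x e * c e i"] by (simp add: algebra_simps)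
      qed
      then show "\<exists>a f'. \<forall>i\<in>I. [f i = (\<Sum>e\<in>E - {d}. a e * c e i) + int p * f' i] (mod int n)"
        using x by (intro exI[of _ "\<lambda>e. x e - x d * t * b e"] exI[of _ "\<lambda>i. x d * t * w i - x d * s * c d i"]) simp
    qed
    then show False using min[OF d] by blast
  qed
  have "\<forall>e\<in>E. int p ^ j dvd a e" if "j \<le> k" for j
    using that
  proof (induction j)
    case (Suc j)
    then have "\<forall>e\<in>E. \<exists>b. a e = int p ^ j * b" by (auto simp: dvd_def)
    then obtain b where b: "\<And>e. e \<in> E \<Longrightarrow> a e = int p ^ j * b e" by metis
    have "int p dvd (\<Sum>e\<in>E. b e * c e i)" if i: "i \<in> I" for i
    proof -
      have "int p ^ Suc j dvd int n" unfolding n of_nat_power using Suc.prems by (intro le_imp_power_dvd)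
      also have "int n dvd (\<Sum>e\<in>E. a e * c e i)" using a[OF i] by (simp add: cong_0_iff)
      also have "(\<Sum>e\<in>E. a e * c e i) = int p ^ j * (\<Sum>e\<in>E. b e * c e i)"
        by (simp add: b sum_distrib_left mult.assoc)
      finally show ?thesis using p by (simp add: mult.commute[of "int p"] prime_gt_0_nat)
    qed
    then show ?case using mod_p[of b] b by (auto simp: mult.commute mult_dvd_mono)
  qed simp
  then show ?thesis using e n by (simp add: cong_0_iff)
qed

text \<open>The coordinates with respect to a minimal spanning subset are unique modulo \<open>n\<close> by independence.
  Such a subset has at least two elements, since multiples of a single element cannot realize the
  unit vectors at both \<open>i0\<close> and \<open>i1\<close>.\<close>

lemma basis_change:
  assumes n: "n = p ^ k" and p: "prime p" and rank: "i0 \<in> I" "i1 \<in> I" "i0 \<noteq> i1"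
    and S: "S \<subseteq> V" "spans S"
  obtains E c' where "E \<subseteq> S" "basis_coordinates V Z E n c'"
proof -
  obtain E where E: "E \<subseteq> S" "spans E" and least: "\<And>F. F \<subseteq> S \<Longrightarrow> spans F \<Longrightarrow> card E \<le> card F"
    using ex_has_least_nat[of "\<lambda>E. E \<subseteq> S \<and> spans E" S card] S(2) that by auto
  have EV: "E \<subseteq> V" and finite_E: "finite E" using E(1) S(1) finite_subset[OF _ finite_V] by auto
  have min: "\<not> spans (E - {e})" if "e \<in> E" for e
  proof
    assume "spans (E - {e})"
    then have "card E \<le> card (E - {e})" using E(1) by (intro least) auto
    then show False using that finite_E by (metis card_Diff1_less not_le)
  qed
  have unique: "[a e = b e] (mod int n)"
    if eq: "\<And>i. i \<in> I \<Longrightarrow> [(\<Sum>e\<in>E. a e * c e i) = (\<Sum>e\<in>E. b e * c e i)] (mod int n)"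
      and e: "e \<in> E" for a b e
  proof -
    have "[(\<Sum>e\<in>E. (a e - b e) * c e i) = 0] (mod int n)" if i: "i \<in> I" for i
      using eq[OF i] by (simp add: left_diff_distrib sum_subtractf cong_iff_dvd_diff)
    then have "[a e - b e = 0] (mod int n)"
      using minimal_spanning_independent[OF n p finite_E E(2) min, of "\<lambda>e. a e - b e" e] e by blast
    then show ?thesis by (simp add: cong_iff_dvd_diff)
  qed
  have "\<exists>a. \<forall>i\<in>I. [c x i = (\<Sum>e\<in>E. a e * c e i)] (mod int n)" for x
    using E(2) unfolding spans_def by blast
  then obtain a where a: "\<And>x i. i \<in> I \<Longrightarrow> [c x i = (\<Sum>e\<in>E. a x e * c e i)] (mod int n)" by metis
  define c' where "c' x e = a x e mod int n" for x e
  have c': "[c x i = (\<Sum>e\<in>E. c' x e * c e i)] (mod int n)" if "i \<in> I" for x i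
  proof -
    have "[(\<Sum>e\<in>E. a x e * c e i) = (\<Sum>e\<in>E. c' x e * c e i)] (mod int n)"
      unfolding c'_def by (intro cong_sum cong_mult) (auto simp: cong_def)
    then show ?thesis using a[OF that] cong_trans by blast
  qed
  have "coordinates V Z E n c'"
  proof
    show "finite E" by (rule finite_E)
    show "3 \<le> n" by (rule n_ge_3)
    show "x = y" if xy: "x \<in> V" "y \<in> V" and eq: "\<And>e. e \<in> E \<Longrightarrow> [c' x e = c' y e] (mod int n)" for x y
    proof (rule coord_inj[OF xy])
      fix i assume i: "i \<in> I"
      have "[(\<Sum>e\<in>E. c' x e * c e i) = (\<Sum>e\<in>E. c' y e * c e i)] (mod int n)"
        by (intro cong_sum cong_mult eq cong_refl)
      then show "[c x i = c y i] (mod int n)" using c'[OF i] cong_trans cong_sym by blast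
    qed
    show "\<exists>x\<in>V. \<forall>e\<in>E. [c' x e = f e] (mod int n)" for f
    proof -
      obtain x where x: "x \<in> V" "\<And>i. i \<in> I \<Longrightarrow> [c x i = (\<Sum>e\<in>E. f e * c e i)] (mod int n)"
        using coord_surj[of "\<lambda>i. \<Sum>e\<in>E. f e * c e i"] by blast
      have "[(\<Sum>e\<in>E. c' x e * c e i) = (\<Sum>e\<in>E. f e * c e i)] (mod int n)" if "i \<in> I" for i
        using c'[OF that] x(2)[OF that] cong_trans cong_sym by blast
      then show ?thesis using unique[of "c' x" f] x(1) by blast
    qed
    show "T \<in> Z \<longleftrightarrow> set_mset T \<subseteq> V \<and> (\<forall>e\<in>E. [(\<Sum>x\<in>#T. c' x e) = 0] (mod int n))" for T
    proof -
      have sum: "[(\<Sum>x\<in>#T. c x i) = (\<Sum>e\<in>E. (\<Sum>x\<in>#T. c' x e) * c e i)] (mod int n)" if i: "i \<in> I" for i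
      proof (induction T)
        case (add x T)
        then show ?case using cong_add[OF c'[OF i, of x] add.IH] by (simp add: distrib_right sum.distrib)
      qed simp
      have "(\<forall>i\<in>I. [(\<Sum>x\<in>#T. c x i) = 0] (mod int n)) \<longleftrightarrow> (\<forall>e\<in>E. [(\<Sum>x\<in>#T. c' x e) = 0] (mod int n))"
      proof (intro iffI ballI)
        fix e assume *: "\<forall>i\<in>I. [(\<Sum>x\<in>#T. c x i) = 0] (mod int n)" and e: "e \<in> E"
        have "[(\<Sum>e\<in>E. (\<Sum>x\<in>#T. c' x e) * c e i) = 0] (mod int n)" if "i \<in> I" for i
          using * sum[OF that] that cong_trans cong_sym by blast
        then show "[(\<Sum>x\<in>#T. c' x e) = 0] (mod int n)"
          using unique[of "\<lambda>e. \<Sum>x\<in>#T. c' x e" "\<lambda>_. 0"] e by simp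
      next
        fix i assume *: "\<forall>e\<in>E. [(\<Sum>x\<in>#T. c' x e) = 0] (mod int n)" and i: "i \<in> I"
        have "[(\<Sum>e\<in>E. (\<Sum>x\<in>#T. c' x e) * c e i) = (\<Sum>e\<in>E. 0 * c e i)] (mod int n)"
          using * by (intro cong_sum cong_mult) auto
        then show "[(\<Sum>x\<in>#T. c x i) = 0] (mod int n)" using sum[OF i] cong_trans by fastforce
      qed
      then show ?thesis using mem_Z by simp
    qed
  qed
  moreover have "c' e d = (if e = d then 1 else 0)" if e: "e \<in> E" and d: "d \<in> E" for e d
  proof -
    have "(\<Sum>d\<in>E. (if e = d then 1 else 0) * c d i) = (\<Sum>d\<in>E. if e = d then c d i else 0)" for i
      by (intro sum.cong) auto
    then have "(\<Sum>d\<in>E. (if e = d then 1 else 0) * c d i) = c e i" for i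
      using e finite_E by (simp add: sum.delta)
    then have "[c' e d = (if e = d then 1 else 0)] (mod int n)"
      using unique[of "c' e" "\<lambda>d. if e = d then 1 else 0" d] cong_sym[OF c'[of _ e]] d by simp
    then show ?thesis using n_ge_3 by (auto simp: cong_def c'_def)
  qed
  moreover have "0 \<le> c' x e \<and> c' x e < int n" for x e using n_ge_3 by (simp add: c'_def)
  moreover have "2 \<le> card E"
  proof (rule ccontr)
    assume "\<not> 2 \<le> card E"
    then have "card E = 0 \<or> card E = 1" by linarith
    then obtain d where "E \<subseteq> {d}" using finite_E by (metis card_0_eq card_1_singletonE empty_subsetI order_refl)
    then have sum: "\<exists>m. \<forall>i. (\<Sum>e\<in>E. x e * c e i) = m * c d i" for x :: "'g \<Rightarrow> int"
      by (cases "E = {}") (auto simp: subset_singleton_iff intro: exI[of _ 0])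
    have "\<exists>m. \<forall>i\<in>I. [f i = m * c d i] (mod int n)" for f
    proof -
      obtain x where x: "\<forall>i\<in>I. [f i = (\<Sum>e\<in>E. x e * c e i)] (mod int n)"
        using E(2) unfolding spans_def by blast
      then show ?thesis using sum[of x] by metis
    qed
    from this[of "\<lambda>i. if i = i0 then 1 else 0"] this[of "\<lambda>i. if i = i1 then 1 else 0"]
    obtain l m where l: "\<forall>i\<in>I. [(if i = i0 then 1 else 0) = l * c d i] (mod int n)"
      and m: "\<forall>i\<in>I. [(if i = i1 then 1 else 0) = m * c d i] (mod int n)" by blast
    have "[1 = l * c d i0] (mod int n)" "[0 = l * c d i1] (mod int n)" "[1 = m * c d i1] (mod int n)"
      using l m rank by (auto dest!: bspec[of _ _ i0] bspec[of _ _ i1] split: if_splits)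
    then have "[1 * 1 = (l * c d i0) * (m * c d i1)] (mod int n)" "[0 * (m * c d i0) = (l * c d i1) * (m * c d i0)] (mod int n)"
      using cong_mult cong_refl by blast+
    then have "[1 = (0::int)] (mod int n)"
      by (simp add: ac_simps) (meson cong_sym cong_trans)
    then show False using n_ge_3 by (simp add: cong_0_iff)
  qed
  ultimately show thesis
    using EV by (intro that[OF E(1)]) (auto simp: basis_coordinates_def basis_coordinates_axioms_def)
qed

end

section \<open>Sets of lengths of maximal elasticity over homocyclic groups\<close>

lemma cyclic_power_coordinates:
  assumes G: "comm_group G" and \<phi>: "\<phi> \<in> iso G (cyclic_power n r)" and n: "3 \<le> n"
  shows "coordinates (carrier G) (carrier (zero_sum_monoid G)) {..<r} n \<phi>"
proof -
  interpret comm_group G by (rule G)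
  let ?C = "cyclic_power n r"
  have carrier: "carrier ?C = (\<Pi>\<^sub>E i\<in>{..<r}. {0..<int n})"
    using n unfolding cyclic_power_def
    by (simp add: carrier_sum_group carrier_integer_mod_group)
  have mult: "x \<otimes>\<^bsub>?C\<^esub> y = (\<lambda>i\<in>{..<r}. (x i + y i) mod int n)" for x y
    by (simp add: cyclic_power_def)
  have hom: "\<phi> \<in> hom G ?C" and bij: "bij_betw \<phi> (carrier G) (carrier ?C)"
    using \<phi> by (auto simp: iso_def)
  have one: "\<phi> \<one>\<^bsub>G\<^esub> = (\<lambda>i\<in>{..<r}. 0)"
    using hom_one[OF hom group_axioms] unfolding cyclic_power_def by simp
  have range: "\<phi> x \<in> (\<Pi>\<^sub>E i\<in>{..<r}. {0..<int n})" if "x \<in> carrier G" for x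
    using bij that carrier by (auto dest: bij_betwE)
  have inj: "x = y" if xy: "x \<in> carrier G" "y \<in> carrier G"
    and eq: "\<And>i. i \<in> {..<r} \<Longrightarrow> [\<phi> x i = \<phi> y i] (mod int n)" for x y
  proof -
    have "\<phi> x i = \<phi> y i" if "i \<in> {..<r}" for i
      using eq[OF that] PiE_mem[OF range[OF xy(1)] that] PiE_mem[OF range[OF xy(2)] that]
      by (simp add: cong_def)
    then have "\<phi> x = \<phi> y" using PiE_ext[OF range[OF xy(1)] range[OF xy(2)]] by blast
    then show "x = y" using bij xy by (auto dest: bij_betw_imp_inj_on inj_onD)
  qed
  have surj: "\<exists>x\<in>carrier G. \<forall>i\<in>{..<r}. [\<phi> x i = f i] (mod int n)" for f
  proof -
    have "(\<lambda>i\<in>{..<r}. f i mod int n) \<in> carrier ?C" using n by (auto simp: carrier)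
    then have "(\<lambda>i\<in>{..<r}. f i mod int n) \<in> \<phi> ` carrier G" using bij by (simp add: bij_betw_def)
    then obtain x where "x \<in> carrier G" "\<phi> x = (\<lambda>i\<in>{..<r}. f i mod int n)" by auto
    then show ?thesis by (intro bexI[of _ x]) auto
  qed
  have closed: "list_prod G gs \<in> carrier G" if "set gs \<subseteq> carrier G" for gs
    using list_prod_closed[OF monoid_axioms that] .
  have sum: "[\<phi> (list_prod G gs) i = (\<Sum>g\<in>#mset gs. \<phi> g i)] (mod int n)"
    if "set gs \<subseteq> carrier G" "i \<in> {..<r}" for gs i
    using that(1)
  proof (induction gs)
    case Nil
    then show ?case using that(2) by (simp add: list_prod_Nil one)
  next
    case (Cons g gs)
    have "\<phi> (list_prod G (g # gs)) i = (\<phi> g i + \<phi> (list_prod G gs) i) mod int n"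
      using hom Cons.prems closed[of gs] that(2) by (simp add: list_prod_Cons hom_def mult)
    moreover have "[\<phi> g i + \<phi> (list_prod G gs) i = \<phi> g i + (\<Sum>g\<in>#mset gs. \<phi> g i)] (mod int n)"
      using Cons by (intro cong_add) auto
    ultimately show ?case by (simp add: cong_def)
  qed
  have zero_sum: "list_prod G gs = \<one>\<^bsub>G\<^esub> \<longleftrightarrow> (\<forall>i\<in>{..<r}. [(\<Sum>g\<in>#mset gs. \<phi> g i) = 0] (mod int n))"
    if gs: "set gs \<subseteq> carrier G" for gs
  proof
    assume eq: "list_prod G gs = \<one>\<^bsub>G\<^esub>"
    show "\<forall>i\<in>{..<r}. [(\<Sum>g\<in>#mset gs. \<phi> g i) = 0] (mod int n)"
    proof
      fix i assume "i \<in> {..<r}"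
      then show "[(\<Sum>g\<in>#mset gs. \<phi> g i) = 0] (mod int n)"
        using cong_sym[OF sum[OF gs]] by (simp add: eq one)
    qed
  next
    assume *: "\<forall>i\<in>{..<r}. [(\<Sum>g\<in>#mset gs. \<phi> g i) = 0] (mod int n)"
    show "list_prod G gs = \<one>\<^bsub>G\<^esub>"
    proof (rule inj[OF closed[OF gs] one_closed])
      fix i assume i: "i \<in> {..<r}"
      then show "[\<phi> (list_prod G gs) i = \<phi> \<one>\<^bsub>G\<^esub> i] (mod int n)"
        using cong_trans[OF sum[OF gs i]] * by (simp add: one)
    qed
  qed
  have mem: "S \<in> carrier (zero_sum_monoid G) \<longleftrightarrow>
      set_mset S \<subseteq> carrier G \<and> (\<forall>i\<in>{..<r}. [(\<Sum>x\<in>#S. \<phi> x i) = 0] (mod int n))" for S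
  proof -
    obtain gs where S: "mset gs = S" using ex_mset by blast
    have "S \<in> carrier (zero_sum_monoid G) \<longleftrightarrow>
        (\<exists>hs. mset hs = S \<and> set hs \<subseteq> carrier G \<and> list_prod G hs = \<one>\<^bsub>G\<^esub>)"
      by (auto simp: zero_sum_monoid_def free_abelian_monoid_def)
    also have "\<dots> \<longleftrightarrow> set_mset S \<subseteq> carrier G \<and> (\<forall>i\<in>{..<r}. [(\<Sum>x\<in>#S. \<phi> x i) = 0] (mod int n))"
      using zero_sum S by (metis set_mset_mset)
    finally show ?thesis .
  qed
  show ?thesis by unfold_locales (use n inj surj mem in auto)
qed

theorem theorem3p11:
  fixes k r p :: nat
    and G :: "('g, 'n) monoid_scheme"
    and H :: "('a, 'm) monoid_scheme"
  assumes "k \<ge> 1" and "r \<ge> 2" and "Factorial_Ring.prime p" and "p ^ k \<ge> 3"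
    and "comm_group G" and "G \<cong> cyclic_power (p ^ k) r"
    and "transfer_Krull H G"
  shows "Delta_rho H = {1}"
proof -
  let ?Z = "carrier (zero_sum_monoid G)"
  obtain \<phi> where \<phi>: "\<phi> \<in> iso G (cyclic_power (p ^ k) r)" using assms(6) by (auto simp: is_iso_def)
  interpret coordinates "carrier G" ?Z "{..<r}" "p ^ k" \<phi>
    using cyclic_power_coordinates[OF assms(5) \<phi> assms(4)] .
  obtain \<theta> where \<theta>: "weak_transfer_hom H (zero_sum_monoid G) \<theta>"
    using assms(7) by (auto simp: transfer_Krull_def)
  then have B: "monoid (zero_sum_monoid G)" by (simp add: weak_transfer_hom_def)
  have lengths: "system_of_lengths H = factor_lengths ?Z ` ?Z"
    using weak_transfer_hom_system_of_lengths[OF \<theta>] lengths_zero_sum_monoid[OF B diff_in_Z]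
    by (simp add: system_of_lengths_def)
  have basis: "\<exists>E c. E \<subseteq> set_mset U \<and> basis_coordinates (carrier G) ?Z E (p ^ k) c"
    if U: "U \<in> zs_atoms ?Z" "size U = davenport" for U
  proof -
    have "set_mset U \<subseteq> carrier G" using atom_in_Z[OF U(1)] by (simp add: mem_Z)
    then show ?thesis
      using basis_change[OF refl assms(3), of 0 1 "set_mset U"] spans_max_atom[OF U] assms(2) by force
  qed
  have neg_eq: "coordinates.neg (carrier G) E (p ^ k) c x = neg x"
    if E: "basis_coordinates (carrier G) ?Z E (p ^ k) c" and x: "x \<in> carrier G" for E c x
  proof -
    interpret E: basis_coordinates "carrier G" ?Z E "p ^ k" c by (rule E)
    show ?thesis using pair_in_Z_iff[OF x] E.pair_in_Z_iff[OF x] by blast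
  qed
  show ?thesis
  proof (rule Delta_rho_eq_1[OF lengths])
    obtain U where U: "U \<in> zs_atoms ?Z" "size U = davenport" using davenport_attained by blast
    obtain E c where E: "basis_coordinates (carrier G) ?Z E (p ^ k) c" using basis[OF U] by blast
    interpret E: basis_coordinates "carrier G" ?Z E "p ^ k" c by (rule E)
    have "2 * 2 \<le> card E * (p ^ k - 1)" using E.rank_ge_2 n_ge_3 by (intro mult_le_mono) auto
    then show "3 \<le> davenport" using E.davenport_lower_bound by linarith
  next
    fix U assume U: "U \<in> zs_atoms ?Z" "size U = davenport"
    obtain E c where EU: "E \<subseteq> set_mset U" and E: "basis_coordinates (carrier G) ?Z E (p ^ k) c"
      using basis[OF U] by blast
    interpret E: basis_coordinates "carrier G" ?Z E "p ^ k" c by (rule E)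
    have "E.neg ` set_mset U = neg ` set_mset U"
      using neg_eq[OF E] atom_in_Z[OF U(1)] by (intro image_cong) (auto simp: mem_Z)
    then show "\<exists>C\<in>?Z. set_mset C \<subseteq> set_mset U \<union> neg ` set_mset U \<and>
        (\<exists>y. y \<in> factor_lengths ?Z C \<and> y + 1 \<in> factor_lengths ?Z C)"
      using E.max_atom_consecutive_lengths[OF U EU] by simp
  qed
qed

end
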